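(* Let $q$ be a complex number with $0<|q|<1$. Then the following three identities hold: \begin{align*} \sum_{i,j,k\ge 0}\frac{q^{i^2+4j^2+3k^2+2ij+4jk+i-2k}}{(q^2;q^2)_i(q^2;q^2)_j(q^4;q^4)_k} &=\frac{J_4J_{14}J_{28}^2J_{2,28}}{J_2J_{1,28}J_{4,28}J_{8,28}J_{13,28}},\\ \sum_{i,j,k\ge 0}\frac{q^{i^2+4j^2+3k^2+2ij+4jk+i}}{(q^2;q^2)_i(q^2;q^2)_j(q^4;q^4)_k} &=\frac{J_4J_{14}J_{28}^2J_{6,28}}{J_2J_{3,28}J_{4,28}J_{11,28}J_{12,28}},\\ \sum_{i,j,k\ge 0}\frac{q^{i^2+4j^2+3k^2+2ij+4jk+i+4j+2k}}{(q^2;q^2)_i(q^2;q^2)_j(q^4;q^4)_k} &=\frac{J_4J_{14}J_{28}^2J_{10,28}}{J_2J_{5,28}J_{8,28}J_{9,28}J_{12,28}}. \end{align*}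
   Context: For $|q|<1$: $(a;q)_\infty=\prod_{m=0}^\infty(1-aq^m)$, $(a;q)_n=(a;q)_\infty/(aq^n;q)_\infty=\prod_{m=0}^{n-1}(1-aq^m)$ for integers $n\ge0$, and $(a_1,\dots,a_r;q)_\infty=(a_1;q)_\infty\cdots(a_r;q)_\infty$; the same notation is used with the base $q$ replaced by a power of $q$. Moreover $J_m=(q^m;q^m)_\infty$ and $J_{a,m}=(q^a,q^{m-a},q^m;q^m)_\infty$. *)

theory Defs
  imports "HOL-Analysis.Analysis"
begin

definition qpoch :: "complex \<Rightarrow> complex \<Rightarrow> nat \<Rightarrow> complex" where
  "qpoch a q n = (\<Prod>m<n. 1 - a * q ^ m)"

definition qpoch_inf :: "complex \<Rightarrow> complex \<Rightarrow> complex" where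
  "qpoch_inf a q = prodinf (\<lambda>m. 1 - a * q ^ m)"

text \<open>
  The product \<open>qpoch_inf a q\<close> is meaningful for every \<open>a\<close> when \<open>norm q < 1\<close>.  The functional
  equation \<open>qpoch_inf_split\<close> is the relation
  \<open>(a;q)\<^sub>n = (a;q)\<^sub>\<infinity> / (a q\<^sup>n;q)\<^sub>\<infinity>\<close>, without dividing by a possibly vanishing product.
\<close>

lemma convergent_qpoch_inf:
  assumes "norm q < 1"
  shows "convergent_prod (\<lambda>m. 1 - a * q ^ m :: complex)"
proof -
  have "summable (\<lambda>m. norm a * norm q ^ m)"
    using assms by (intro summable_mult summable_geometric) simp
  then have "summable (\<lambda>m. norm ((1 - a * q ^ m) - 1))"
    by (simp add: norm_mult norm_power)
  then show ?thesis
    by (intro abs_convergent_prod_imp_convergent_prod summable_imp_abs_convergent_prod)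
qed

lemma qpoch_inf_split:
  assumes "norm q < 1"
  shows "qpoch_inf a q = qpoch a q n * qpoch_inf (a * q ^ n) q"
proof -
  let ?P = "\<lambda>b N. \<Prod>m<N. 1 - b * q ^ m"
  have lim: "?P b \<longlonglongrightarrow> qpoch_inf b q" for b
    using convergent_prod_LIMSEQ[OF convergent_qpoch_inf[OF assms, of b]]
    unfolding qpoch_inf_def by (simp add: LIMSEQ_lessThan_iff_atMost)
  have eq: "?P a (N + n) = qpoch a q n * ?P (a * q ^ n) N" for N
    by (induction N) (simp_all add: qpoch_def power_add algebra_simps)
  have "(\<lambda>N. ?P a (N + n)) \<longlonglongrightarrow> qpoch_inf a q"
    using lim by (rule LIMSEQ_ignore_initial_segment)
  moreover have "(\<lambda>N. ?P a (N + n)) \<longlonglongrightarrow> qpoch a q n * qpoch_inf (a * q ^ n) q"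
    unfolding eq by (intro tendsto_mult tendsto_const lim)
  ultimately show ?thesis
    by (rule LIMSEQ_unique)
qed

definition J1 :: "complex \<Rightarrow> nat \<Rightarrow> complex" where
  "J1 q m = qpoch_inf (q ^ m) (q ^ m)"

text \<open>The integer exponent avoids truncated subtraction in \<open>q\<^sup>m\<^sup>-\<^sup>a\<close>.\<close>

definition J2 :: "complex \<Rightarrow> nat \<Rightarrow> nat \<Rightarrow> complex" where
  "J2 q a m =
     qpoch_inf (q ^ a) (q ^ m) * qpoch_inf (q powi (int m - int a)) (q ^ m) *
     qpoch_inf (q ^ m) (q ^ m)"

end

theory Submission
  imports Defs
begin

text \<open>
  Put \<open>Q = q\<^sup>4\<close>.  For fixed \<open>j\<close> the sum over \<open>i\<close> is one of Euler's series and equals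
  \<open>(-q\<^bsup>2+2j\<^esup>;q\<^sup>2)\<^sub>\<infinity>\<close>.  Since \<open>(q\<^sup>2;q\<^sup>2)\<^sub>j (-q\<^sup>2;q\<^sup>2)\<^sub>j = (Q;Q)\<^sub>j\<close>, each triple sum is
  \<open>(-q\<^sup>2;q\<^sup>2)\<^sub>\<infinity> = J\<^sub>4 / J\<^sub>2\<close> times a double sum of \<open>q\<close> to the power \<open>(2j+k)\<^sup>2 + 2k\<^sup>2 + \<dots>\<close> over
  \<open>(Q;Q)\<^sub>j (Q;Q)\<^sub>k\<close> (lemma \<open>triple_sum_reduction\<close>).

  The double sums are evaluated by a Bailey argument.  Suppose that a power of \<open>q\<close> (or a difference of two
  of them) is written as \<open>f(k) = \<Sum>\<^sub>s [k;s] \<alpha>(k - 2s)\<close>, with Gaussian binomials \<open>[k;s]\<close> to the base \<open>Q\<close>.  Substituting this and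
  collecting the terms with the same \<open>r = k - 2s\<close> leaves, for each \<open>r\<close>, a sum that the
  \<open>q\<close>-Vandermonde and Durfee identities evaluate.  The result (theorem \<open>bailey_transform\<close>) is
  \<open>\<Sum>\<^sub>j\<^sub>,\<^sub>k q\<^bsup>(2j+k)\<^sup>2+k\<^sup>2\<^esup> f(k) / ((Q;Q)\<^sub>j (Q;Q)\<^sub>k) = (\<Sum>\<^sub>r \<alpha>(r) q\<^bsup>2r\<^sup>2\<^esup>) / (Q;Q)\<^sub>\<infinity>\<close>.
  Allowing all integers \<open>r\<close> treats even and odd \<open>k\<close>, which belong to different classical Bailey pairs, at once.

  The weights that are needed are, up to a translation of \<open>r\<close>, of the form
  \<open>\<alpha>(r) = \<epsilon>(r) q\<^bsup>(r\<^sup>2+cr)/3\<^esup>\<close>, where the sign \<open>\<epsilon>\<close> has period six and is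
  antisymmetric about \<open>r = 1\<close>.  In the first two cases, one of the two parts of Pascal's recurrence for such a sum has odd
  weights and vanishes, so that the sum is a single power of \<open>q\<close>; the third case reduces to these (lemmas \<open>qsum_middle\<close>, \<open>qsum_lower\<close>,
  \<open>qsum_upper\<close>).  Working with a complex number \<open>g\<close> such that \<open>g\<^sup>3 = q\<close> keeps all exponents integral.

  Finally \<open>\<Sum>\<^sub>r \<epsilon>(r) g\<^bsup>7r\<^sup>2+cr\<^esup>\<close> is a quintuple product.  The quintuple product identity follows by multiplying
  two instances of Jacobi's triple product and reading off the coefficients, which are pentagonal number series;
  Jacobi's identity in turn comes from the same two ingredients, Euler's series and the Durfee identity.
  What remains is to sort the factors of the infinite products by residues modulo 28.
\<close>

section \<open>Finite q-shifted factorials and Gaussian binomial coefficients\<close>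

lemma qpoch_0 [simp]: "qpoch a q 0 = 1"
  by (simp add: qpoch_def)

lemma qpoch_Suc: "qpoch a q (Suc n) = qpoch a q n * (1 - a * q ^ n)"
  by (simp add: qpoch_def)

lemma one_minus_mult_power_nonzero:
  fixes a q :: complex
  assumes "norm a < 1" "norm q < 1"
  shows "1 - a * q ^ n \<noteq> 0"
proof
  assume "1 - a * q ^ n = 0"
  then have "norm (a * q ^ n) = 1" by simp
  moreover have "norm (a * q ^ n) < 1"
  proof -
    have "norm (a * q ^ n) \<le> norm a * 1"
      unfolding norm_mult norm_power
      using assms by (intro mult_left_mono power_le_one) auto
    then show ?thesis using assms by simp
  qed
  ultimately show False by simp
qed

lemma qpoch_nonzero:
  assumes "norm a < 1" "norm q < 1"
  shows "qpoch a q n \<noteq> 0"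
  using one_minus_mult_power_nonzero[OF assms] by (simp add: qpoch_def)

lemma qpoch_LIMSEQ:
  assumes "norm q < 1"
  shows "qpoch a q \<longlonglongrightarrow> qpoch_inf a q"
  using convergent_prod_LIMSEQ[OF convergent_qpoch_inf[OF assms, of a]]
  unfolding qpoch_inf_def qpoch_def by (simp add: LIMSEQ_lessThan_iff_atMost)

lemma qpoch_inf_nonzero:
  assumes "norm a < 1" "norm q < 1"
  shows "qpoch_inf a q \<noteq> 0"
  unfolding qpoch_inf_def
  using convergent_qpoch_inf[OF assms(2)] one_minus_mult_power_nonzero[OF assms]
  by (intro prodinf_nonzero)

lemma inverse_qpoch_bounded:
  assumes "norm a < 1" "norm q < 1"
  obtains K where "K > 0" "\<And>n. norm (1 / qpoch a q n) \<le> K"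
proof -
  have "(\<lambda>n. 1 / qpoch a q n) \<longlonglongrightarrow> 1 / qpoch_inf a q"
    by (intro tendsto_intros qpoch_LIMSEQ qpoch_inf_nonzero assms)
  then have "Bseq (\<lambda>n. 1 / qpoch a q n)"
    by (intro convergent_imp_Bseq) (auto simp: convergent_def)
  then show ?thesis
    using that by (auto simp: Bseq_def)
qed

definition qbinom :: "complex \<Rightarrow> nat \<Rightarrow> nat \<Rightarrow> complex" where
  "qbinom q n s = (if s \<le> n then qpoch q q n / (qpoch q q s * qpoch q q (n - s)) else 0)"

lemma qbinom_0_right:
  assumes "norm q < 1"
  shows "qbinom q n 0 = 1"
  using qpoch_nonzero[OF assms assms] by (simp add: qbinom_def)

lemma qbinom_symmetric:
  assumes "s \<le> n"
  shows "qbinom q n (n - s) = qbinom q n s"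
  using assms by (simp add: qbinom_def)

lemma qbinom_pascal:
  assumes "norm q < 1"
  shows "qbinom q (Suc n) (Suc s) = qbinom q n (Suc s) + q ^ (n - s) * qbinom q n s"
proof -
  note nz = qpoch_nonzero[OF assms assms] one_minus_mult_power_nonzero[OF assms assms]
  consider "s < n" | "s = n" | "s > n" by linarith
  then show ?thesis
  proof cases
    case 1
    then obtain d where n: "n = s + Suc d" using less_imp_Suc_add by auto
    show ?thesis
      using nz[of s] nz[of d] nz[of n]
      by (simp add: qbinom_def n qpoch_Suc divide_simps) (simp add: algebra_simps power_add)
  qed (use nz in \<open>auto simp: qbinom_def qpoch_Suc\<close>)
qed

text \<open>
  Pascal's rule splits the sum for \<open>m + 1\<close> into the sum for \<open>(m, r)\<close> and, after shifting \<open>s\<close>, a multiple of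
  the sum for \<open>(m, r + 1)\<close>; generalising over \<open>r\<close> therefore makes the induction on \<open>m\<close> close.
\<close>

lemma q_vandermonde:
  assumes "norm q < 1"
  shows "(\<Sum>s\<le>m. qbinom q m s * q ^ (s\<^sup>2 + s * r) / qpoch q q (s + r)) = 1 / qpoch q q (m + r)"
proof (induction m arbitrary: r)
  case 0
  show ?case by (simp add: qbinom_0_right[OF assms])
next
  case (Suc m)
  note nz = qpoch_nonzero[OF assms assms] one_minus_mult_power_nonzero[OF assms assms]
  define t where "t r s = q ^ (s\<^sup>2 + s * r) / qpoch q q (s + r)" for r s
  have IH: "(\<Sum>s\<le>m. qbinom q m s * t r s) = 1 / qpoch q q (m + r)" for r
    using Suc.IH[of r] by (simp add: t_def)
  have shift: "q ^ (m - s) * t r (Suc s) = q ^ (m + r + 1) * t (Suc r) s" if "s \<le> m" for s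
  proof -
    have "(m - s) + ((Suc s)\<^sup>2 + Suc s * r) = (m + r + 1) + (s\<^sup>2 + s * Suc r)"
      using that by (simp add: power2_eq_square)
    then have e: "q ^ (m - s) * q ^ ((Suc s)\<^sup>2 + Suc s * r) = q ^ (m + r + 1) * q ^ (s\<^sup>2 + s * Suc r)"
      by (simp only: flip: power_add)
    show ?thesis
      unfolding t_def times_divide_eq_right e by simp
  qed
  have "(\<Sum>s\<le>Suc m. qbinom q (Suc m) s * t r s)
      = t r 0 + (\<Sum>s\<le>m. qbinom q (Suc m) (Suc s) * t r (Suc s))"
    by (simp only: sum.atMost_Suc_shift) (simp add: qbinom_0_right[OF assms])
  also have "\<dots> = (t r 0 + (\<Sum>s\<le>m. qbinom q m (Suc s) * t r (Suc s)))
                 + (\<Sum>s\<le>m. qbinom q m s * (q ^ (m - s) * t r (Suc s)))"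
    by (simp add: qbinom_pascal[OF assms] algebra_simps sum.distrib)
  also have "t r 0 + (\<Sum>s\<le>m. qbinom q m (Suc s) * t r (Suc s)) = (\<Sum>s\<le>Suc m. qbinom q m s * t r s)"
    by (simp only: sum.atMost_Suc_shift) (simp add: qbinom_0_right[OF assms])
  also have "\<dots> = (\<Sum>s\<le>m. qbinom q m s * t r s)"
    by (simp add: qbinom_def)
  also have "(\<Sum>s\<le>m. qbinom q m s * (q ^ (m - s) * t r (Suc s)))
           = q ^ (m + r + 1) * (\<Sum>s\<le>m. qbinom q m s * t (Suc r) s)"
    unfolding sum_distrib_left by (intro sum.cong refl) (simp add: shift)
  finally have "(\<Sum>s\<le>Suc m. qbinom q (Suc m) s * t r s)
      = 1 / qpoch q q (m + r) + q ^ (m + r + 1) * (1 / qpoch q q (m + Suc r))"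
    by (simp only: IH)
  also have "\<dots> = 1 / qpoch q q (Suc m + r)"
    using nz[of "m + r"] by (simp add: qpoch_Suc divide_simps)
  finally show ?case by (simp add: t_def)
qed

section \<open>The identities of Durfee and Euler\<close>

text \<open>
  This is \<open>q_vandermonde\<close> for \<open>m \<rightarrow> \<infinity>\<close>: in the limit \<open>(q;q)\<^bsub>m-s\<^esub>\<close> becomes the constant \<open>(q;q)\<^sub>\<infinity>\<close>.
  Tannery's theorem, with a geometric majorant, justifies the exchange of limit and sum.
\<close>

lemma durfee_sums:
  fixes q :: complex
  assumes "norm q < 1"
  shows "(\<lambda>s. q ^ (s\<^sup>2 + s * r) / (qpoch q q s * qpoch q q (s + r))) sums (1 / qpoch_inf q q)"
    and "summable (\<lambda>s. norm (q ^ (s\<^sup>2 + s * r) / (qpoch q q s * qpoch q q (s + r))))"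
proof -
  note nz = qpoch_nonzero[OF assms assms] qpoch_inf_nonzero[OF assms assms]
  obtain K where K: "K > 0" "\<And>n. norm (1 / qpoch q q n) \<le> K"
    using inverse_qpoch_bounded[OF assms assms] by blast
  define t where "t s = q ^ (s\<^sup>2 + s * r) / (qpoch q q s * qpoch q q (s + r))" for s
  define a where "a s m = (if s \<le> m then t s * (1 / qpoch q q (m - s)) else 0)" for s m
  have norm_t: "norm (t s) \<le> norm q ^ s * K * K" for s
  proof -
    have "norm (t s) = norm q ^ (s\<^sup>2 + s * r) * norm (1 / qpoch q q s) * norm (1 / qpoch q q (s + r))"
      by (simp add: t_def norm_divide norm_mult norm_power)
    also have "\<dots> \<le> norm q ^ s * K * K"
      using assms K
      by (intro mult_mono power_decreasing) (auto simp: power2_eq_square intro: trans_le_add1)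
    finally show ?thesis .
  qed
  have lim: "(\<lambda>m. a s m) \<longlonglongrightarrow> t s * (1 / qpoch_inf q q)" for s
  proof (rule Lim_transform_eventually)
    have "(\<lambda>m. qpoch q q (m - s)) \<longlonglongrightarrow> qpoch_inf q q"
      by (rule filterlim_compose[OF qpoch_LIMSEQ[OF assms] filterlim_minus_const_nat_at_top])
    then show "(\<lambda>m. t s * (1 / qpoch q q (m - s))) \<longlonglongrightarrow> t s * (1 / qpoch_inf q q)"
      by (intro tendsto_intros nz)
    show "\<forall>\<^sub>F m in sequentially. t s * (1 / qpoch q q (m - s)) = a s m"
      using eventually_ge_at_top[of s] by eventually_elim (simp add: a_def)
  qed
  have bound: "norm (a s m) \<le> norm q ^ s * K * K * K" for s m
  proof (cases "s \<le> m")
    case True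
    then have "norm (a s m) = norm (t s) * norm (1 / qpoch q q (m - s))"
      by (simp add: a_def norm_divide)
    also have "\<dots> \<le> norm q ^ s * K * K * K"
      using norm_t K by (intro mult_mono) auto
    finally show ?thesis .
  qed (use K in \<open>simp add: a_def\<close>)
  have summ: "summable (\<lambda>s. norm q ^ s * K * K * K)"
    using assms by (intro summable_mult2 summable_geometric) simp
  have summ': "summable (\<lambda>s. norm q ^ s * K * K)"
    using assms by (intro summable_mult2 summable_geometric) simp
  have st: "summable (\<lambda>s. norm (t s))"
    by (rule summable_comparison_test'[OF summ', of 0]) (use norm_t in auto)
  then show "summable (\<lambda>s. norm (q ^ (s\<^sup>2 + s * r) / (qpoch q q s * qpoch q q (s + r))))"
    by (simp add: t_def)
  have "(\<lambda>m. suminf (\<lambda>s. a s m)) \<longlonglongrightarrow> suminf (\<lambda>s. t s * (1 / qpoch_inf q q))"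
  proof -
    have ev: "\<forall>\<^sub>F (s, m) in at_top \<times>\<^sub>F sequentially. norm (a s m) \<le> norm q ^ s * K * K * K"
      by (intro always_eventually) (use bound in auto)
    show ?thesis
      using tannerys_theorem[OF lim ev summ] by auto
  qed
  moreover have "suminf (\<lambda>s. a s m) = 1 / (qpoch q q m * qpoch q q (m + r))" for m
  proof -
    have "suminf (\<lambda>s. a s m) = (\<Sum>s\<le>m. a s m)"
      by (rule suminf_finite) (auto simp: a_def)
    also have "\<dots> = (\<Sum>s\<le>m. 1 / qpoch q q m * (qbinom q m s * q ^ (s\<^sup>2 + s * r) / qpoch q q (s + r)))"
      by (rule sum.cong) (use nz in \<open>auto simp: a_def t_def qbinom_def\<close>)
    also have "\<dots> = 1 / qpoch q q m * (1 / qpoch q q (m + r))"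
      unfolding sum_distrib_left[symmetric] q_vandermonde[OF assms] ..
    finally show ?thesis by simp
  qed
  moreover have "(\<lambda>m. 1 / (qpoch q q m * qpoch q q (m + r))) \<longlonglongrightarrow> 1 / (qpoch_inf q q * qpoch_inf q q)"
    using LIMSEQ_ignore_initial_segment[OF qpoch_LIMSEQ[OF assms, of q], of r] nz(2)
    by (intro tendsto_intros qpoch_LIMSEQ assms) auto
  ultimately have "suminf (\<lambda>s. t s * (1 / qpoch_inf q q)) = 1 / (qpoch_inf q q * qpoch_inf q q)"
    using LIMSEQ_unique by simp
  moreover have "summable t" using st by (rule summable_norm_cancel)
  ultimately have "suminf t * (1 / qpoch_inf q q) = 1 / (qpoch_inf q q * qpoch_inf q q)"
    by (simp add: suminf_divide)
  then have "suminf t = 1 / qpoch_inf q q"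
    using nz by (simp add: field_simps)
  with summable_sums[OF \<open>summable t\<close>]
  have "t sums (1 / qpoch_inf q q)" by simp
  then show "(\<lambda>s. q ^ (s\<^sup>2 + s * r) / (qpoch q q s * qpoch q q (s + r))) sums (1 / qpoch_inf q q)"
    by (simp add: t_def[abs_def])
qed

lemma durfee_has_sum:
  fixes q :: complex
  assumes "norm q < 1"
  shows "((\<lambda>s. q ^ (s\<^sup>2 + s * r) / (qpoch q q s * qpoch q q (s + r))) has_sum (1 / qpoch_inf q q)) UNIV"
  using durfee_sums[OF assms] by (intro norm_summable_imp_has_sum)

lemma euler_summable:
  fixes y w :: complex
  assumes "norm y < 1"
  shows "summable (\<lambda>a. norm (y ^ a\<^sup>2 * w ^ a / qpoch (y\<^sup>2) (y\<^sup>2) a))"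
proof -
  have y2: "norm (y\<^sup>2) < 1" using assms by (simp add: norm_power power_less_one_iff abs_square_less_1)
  obtain K where K: "K > 0" "\<And>n. norm (1 / qpoch (y\<^sup>2) (y\<^sup>2) n) \<le> K"
    using inverse_qpoch_bounded[OF y2 y2] by blast
  have lim: "(\<lambda>n. norm y ^ n * norm w) \<longlonglongrightarrow> 0 * norm w"
    using assms by (intro tendsto_intros LIMSEQ_power_zero) simp
  then have "\<forall>\<^sub>F n in sequentially. norm y ^ n * norm w < 1 / 2"
    by (rule order_tendstoD) simp
  \<comment> \<open>The \<open>a\<close>-th term has the size of \<open>(\<bar>y\<bar>\<^sup>a \<bar>w\<bar>)\<^sup>a\<close>, and its base tends to \<open>0\<close>.\<close>
  then obtain N where N: "norm y ^ n * norm w < 1 / 2" if "n \<ge> N" for n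
    by (auto simp: eventually_sequentially)
  have summ: "summable (\<lambda>a. (1/2 :: real) ^ a * K)"
    by (intro summable_mult2 summable_geometric) simp
  show ?thesis
  proof (rule summable_comparison_test'[OF summ, of N])
    fix a assume a: "a \<ge> N"
    have "norm (y ^ a\<^sup>2 * w ^ a / qpoch (y\<^sup>2) (y\<^sup>2) a)
        = (norm y ^ a * norm w) ^ a * norm (1 / qpoch (y\<^sup>2) (y\<^sup>2) a)"
      by (simp add: norm_mult norm_divide norm_power power_mult_distrib power2_eq_square power_mult)
    also have "\<dots> \<le> (1/2) ^ a * K"
      using N[OF a] K by (intro mult_mono power_mono) auto
    finally show "norm (norm (y ^ a\<^sup>2 * w ^ a / qpoch (y\<^sup>2) (y\<^sup>2) a)) \<le> (1/2) ^ a * K" by simp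
  qed
qed

text \<open>
  Call the sum \<open>G(w)\<close>.  Comparing coefficients gives \<open>G(w) = (1 + y w) G(y\<^sup>2 w)\<close>; iterating produces the
  product, because \<open>G\<close> is continuous at \<open>0\<close> with \<open>G(0) = 1\<close>.
\<close>

lemma euler_has_sum:
  fixes y w :: complex
  assumes "norm y < 1"
  shows "((\<lambda>a. y ^ a\<^sup>2 * w ^ a / qpoch (y\<^sup>2) (y\<^sup>2) a) has_sum qpoch_inf (- y * w) (y\<^sup>2)) UNIV"
proof -
  have y2: "norm (y\<^sup>2) < 1" using assms by (simp add: norm_power power_less_one_iff abs_square_less_1)
  note nz = qpoch_nonzero[OF y2 y2] one_minus_mult_power_nonzero[OF y2 y2]
  define c where "c a = y ^ a\<^sup>2 / qpoch (y\<^sup>2) (y\<^sup>2) a" for a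
  define G where "G w = (\<Sum>a. c a * w ^ a)" for w
  have summ: "summable (\<lambda>a. norm (c a * w ^ a))" for w
    using euler_summable[OF assms, of w] by (simp add: c_def)
  note summ' = summable_norm_cancel[OF summ]
  have step: "G w = (1 + y * w) * G (y\<^sup>2 * w)" for w
  proof -
    have coeff: "c (Suc a) * w ^ Suc a - c (Suc a) * (y\<^sup>2 * w) ^ Suc a = y * w * (c a * (y\<^sup>2 * w) ^ a)" for a
    proof -
      have "c (Suc a) * w ^ Suc a - c (Suc a) * (y\<^sup>2 * w) ^ Suc a
          = c (Suc a) * (1 - y\<^sup>2 * (y\<^sup>2) ^ a) * w ^ Suc a"
        by (simp add: algebra_simps power_mult_distrib)
      also have "c (Suc a) * (1 - y\<^sup>2 * (y\<^sup>2) ^ a) = y ^ (Suc a)\<^sup>2 / qpoch (y\<^sup>2) (y\<^sup>2) a"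
        using nz(2)[of a] nz(1)[of a] by (simp add: c_def qpoch_Suc)
      also have "y ^ (Suc a)\<^sup>2 = y * (y\<^sup>2) ^ a * y ^ a\<^sup>2"
        by (simp add: power2_eq_square power_add power_mult_distrib)
      finally show ?thesis
        by (simp add: c_def power_mult_distrib)
    qed
    have "G w - G (y\<^sup>2 * w) = (\<Sum>a. c a * w ^ a - c a * (y\<^sup>2 * w) ^ a)"
      unfolding G_def by (intro suminf_diff summ')
    also have "\<dots> = (\<Sum>a. c (Suc a) * w ^ Suc a - c (Suc a) * (y\<^sup>2 * w) ^ Suc a)"
      using suminf_split_initial_segment[OF summable_diff[OF summ'[of w] summ'[of "y\<^sup>2 * w"]], of 1] by simp
    also have "\<dots> = y * w * G (y\<^sup>2 * w)"
      unfolding coeff G_def by (intro suminf_mult summ')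
    finally show ?thesis by (simp add: algebra_simps)
  qed
  have iter: "G w = qpoch (- y * w) (y\<^sup>2) n * G ((y\<^sup>2) ^ n * w)" for n
  proof (induction n)
    case (Suc n)
    then show ?case using step[of "(y\<^sup>2) ^ n * w"] by (simp add: qpoch_Suc algebra_simps)
  qed simp
  have "isCont G 0"
    unfolding G_def by (rule isCont_powser[of _ 1]) (use summ'[of 1] in auto)
  moreover have "(\<lambda>n. (y\<^sup>2) ^ n * w) \<longlonglongrightarrow> 0 * w"
    by (intro tendsto_intros LIMSEQ_power_zero y2)
  ultimately have "(\<lambda>n. G ((y\<^sup>2) ^ n * w)) \<longlonglongrightarrow> G 0"
    using isCont_tendsto_compose by fastforce
  moreover have "G 0 = 1"
    unfolding G_def powser_zero by (simp add: c_def)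
  ultimately have "(\<lambda>n. qpoch (- y * w) (y\<^sup>2) n * G ((y\<^sup>2) ^ n * w)) \<longlonglongrightarrow> qpoch_inf (- y * w) (y\<^sup>2) * 1"
    by (intro tendsto_mult qpoch_LIMSEQ y2) simp
  then have "G w = qpoch_inf (- y * w) (y\<^sup>2)"
    unfolding iter[symmetric] by (simp add: LIMSEQ_const_iff)
  then have "(\<lambda>a. c a * w ^ a) sums qpoch_inf (- y * w) (y\<^sup>2)"
    using summable_sums[OF summ'[of w]] by (simp add: G_def)
  then show ?thesis
    using norm_summable_imp_has_sum[OF summ[of w]] by (simp add: c_def)
qed

section \<open>Finite theta sums\<close>

text \<open>
  The step \<open>2\<close> in the argument of \<open>\<alpha>\<close> makes the sum invariant under \<open>r \<mapsto> -r\<close>, and lets one family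
  \<open>\<alpha>\<close> on the integers serve both parities of \<open>k\<close>.  Up to the factor \<open>(q;q)\<^sub>k\<close> these are the relations
  between the two halves of a Bailey pair.
\<close>

definition qsum :: "complex \<Rightarrow> (int \<Rightarrow> complex) \<Rightarrow> nat \<Rightarrow> complex" where
  "qsum q \<alpha> k = (\<Sum>s\<le>k. qbinom q k s * \<alpha> (int k - 2 * int s))"

lemma qsum_0 [simp]: "qsum q \<alpha> 0 = \<alpha> 0"
  by (simp add: qsum_def qbinom_def)

lemma qsum_cong: "(\<And>r. \<alpha> r = \<beta> r) \<Longrightarrow> qsum q \<alpha> k = qsum q \<beta> k"
  by (simp add: qsum_def)

lemma qsum_cmult: "qsum q (\<lambda>r. c * \<alpha> r) k = c * qsum q \<alpha> k"
  by (simp add: qsum_def sum_distrib_left mult_ac)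

lemma qsum_reflect: "qsum q (\<lambda>r. \<alpha> (- r)) k = qsum q \<alpha> k"
  unfolding qsum_def
  by (rule sum.reindex_bij_witness[of _ "\<lambda>s. k - s" "\<lambda>s. k - s"])
     (auto simp: qbinom_symmetric of_nat_diff algebra_simps)

lemma qsum_odd:
  assumes "\<And>r. \<alpha> (- r) = - \<alpha> r"
  shows "qsum q \<alpha> k = 0"
proof -
  have "qsum q \<alpha> k = qsum q (\<lambda>r. -1 * \<alpha> r) k"
    using qsum_reflect[of q \<alpha> k] assms by simp
  then show ?thesis unfolding qsum_cmult by simp
qed

lemma qsum_Suc:
  assumes "norm q < 1"
  shows "qsum q \<alpha> (Suc k) = qsum q (\<lambda>r. \<alpha> (r + 1)) k
       + (\<Sum>s\<le>k. q ^ (k - s) * qbinom q k s * \<alpha> (int k - 2 * int s - 1))"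
proof -
  have "qsum q \<alpha> (Suc k) = \<alpha> (int k + 1)
          + (\<Sum>s\<le>k. qbinom q (Suc k) (Suc s) * \<alpha> (int k - 2 * int s - 1))"
    unfolding qsum_def by (simp only: sum.atMost_Suc_shift) (simp add: qbinom_0_right[OF assms] add.commute)
  also have "\<dots> = (\<alpha> (int k + 1) + (\<Sum>s\<le>k. qbinom q k (Suc s) * \<alpha> (int k - 2 * int s - 1)))
       + (\<Sum>s\<le>k. q ^ (k - s) * qbinom q k s * \<alpha> (int k - 2 * int s - 1))"
    by (simp add: qbinom_pascal[OF assms] algebra_simps sum.distrib)
  also have "\<alpha> (int k + 1) + (\<Sum>s\<le>k. qbinom q k (Suc s) * \<alpha> (int k - 2 * int s - 1))
      = (\<Sum>s\<le>Suc k. qbinom q k s * \<alpha> (int k - 2 * int s + 1))"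
    by (simp only: sum.atMost_Suc_shift) (simp add: qbinom_0_right[OF assms])
  also have "\<dots> = qsum q (\<lambda>r. \<alpha> (r + 1)) k"
    by (simp add: qsum_def qbinom_def)
  finally show ?thesis .
qed

text \<open>
  With \<open>q = x\<^sup>2\<close> the factor \<open>q\<^bsup>k-s\<^esup>\<close> in Pascal's rule is \<open>x\<^sup>k x\<^sup>r\<close> for \<open>r = k - 2s\<close>.
  It can thus be absorbed in \<open>\<alpha>\<close>, so that all terms are again sums of the same shape.
\<close>

lemma qsum_Suc_right:
  fixes x :: complex
  assumes "x \<noteq> 0" "norm x < 1"
  shows "qsum (x ^ 2) \<alpha> (Suc k) = qsum (x ^ 2) (\<lambda>r. \<alpha> (r + 1)) k
       + x ^ k * qsum (x ^ 2) (\<lambda>r. x powi r * \<alpha> (r - 1)) k"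
proof -
  have x2: "norm (x\<^sup>2) < 1" using assms by (simp add: norm_power abs_square_less_1)
  have "(x ^ 2) ^ (k - s) = x ^ k * x powi (int k - 2 * int s)" if "s \<le> k" for s
  proof -
    have e: "int (2 * (k - s)) = int k + (int k - 2 * int s)"
      using that by simp
    have "(x ^ 2) ^ (k - s) = x powi int (2 * (k - s))"
      by (simp only: power_int_of_nat power_mult)
    also have "\<dots> = x powi (int k + (int k - 2 * int s))"
      by (simp only: e)
    also have "\<dots> = x ^ k * x powi (int k - 2 * int s)"
      using assms by (subst power_int_add) auto
    finally show ?thesis .
  qed
  then show ?thesis
    unfolding qsum_Suc[OF x2] by (simp add: qsum_def sum_distrib_left mult_ac)
qed

lemma qsum_Suc_left:
  fixes x :: complex
  assumes "x \<noteq> 0" "norm x < 1"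
  shows "qsum (x ^ 2) \<alpha> (Suc k) = qsum (x ^ 2) (\<lambda>r. \<alpha> (r - 1)) k
       + x ^ k * qsum (x ^ 2) (\<lambda>r. x powi (- r) * \<alpha> (r + 1)) k"
proof -
  have "qsum (x ^ 2) \<alpha> (Suc k) = qsum (x ^ 2) (\<lambda>r. \<alpha> (- r)) (Suc k)"
    by (rule qsum_reflect[symmetric])
  also have "\<dots> = qsum (x ^ 2) (\<lambda>r. \<alpha> (- (r + 1))) k
       + x ^ k * qsum (x ^ 2) (\<lambda>r. x powi r * \<alpha> (- (r - 1))) k"
    by (rule qsum_Suc_right[OF assms])
  also have "qsum (x ^ 2) (\<lambda>r. \<alpha> (- (r + 1))) k = qsum (x ^ 2) (\<lambda>r. \<alpha> (r - 1)) k"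
    using qsum_reflect[of "x ^ 2" "\<lambda>r. \<alpha> (r - 1)" k] by simp
  also have "qsum (x ^ 2) (\<lambda>r. x powi r * \<alpha> (- (r - 1))) k
           = qsum (x ^ 2) (\<lambda>r. x powi (- r) * \<alpha> (r + 1)) k"
    using qsum_reflect[of "x ^ 2" "\<lambda>r. x powi (- r) * \<alpha> (r + 1)" k] by (simp add: add.commute)
  finally show ?thesis .
qed

text \<open>
  The values at \<open>0, \<dots>, 5\<close> are \<open>1, 0, -1, -1, 0, 1\<close>.  These are the signs in the quintuple product series; the
  antisymmetry about \<open>1\<close> is what makes the sums below collapse.
\<close>

definition \<epsilon> :: "int \<Rightarrow> complex" where
  "\<epsilon> r = (if r mod 6 \<in> {0, 5} then 1 else if r mod 6 \<in> {2, 3} then - 1 else 0)"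

lemma eps_symmetries:
  shows "\<epsilon> (1 - r) = - \<epsilon> (1 + r)" and "\<epsilon> (- r) = \<epsilon> (r - 1)" and "\<epsilon> (r + 2) = - \<epsilon> (r - 1)"
proof -
  have "r mod 6 \<in> {0..<6}" by simp
  then consider "r mod 6 = 0" | "r mod 6 = 1" | "r mod 6 = 2" | "r mod 6 = 3" | "r mod 6 = 4" | "r mod 6 = 5"
    by force
  then have "\<epsilon> (1 - r) = - \<epsilon> (1 + r) \<and> \<epsilon> (- r) = \<epsilon> (r - 1) \<and> \<epsilon> (r + 2) = - \<epsilon> (r - 1)"
  proof cases
    case 1
    then have "(1 - r) mod 6 = 1" "(1 + r) mod 6 = 1" "(- r) mod 6 = 0" "(r - 1) mod 6 = 5" "(r + 2) mod 6 = 2"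
      by presburger+
    then show ?thesis by (simp add: \<epsilon>_def)
  next
    case 2
    then have "(1 - r) mod 6 = 0" "(1 + r) mod 6 = 2" "(- r) mod 6 = 5" "(r - 1) mod 6 = 0" "(r + 2) mod 6 = 3"
      by presburger+
    then show ?thesis by (simp add: \<epsilon>_def)
  next
    case 3
    then have "(1 - r) mod 6 = 5" "(1 + r) mod 6 = 3" "(- r) mod 6 = 4" "(r - 1) mod 6 = 1" "(r + 2) mod 6 = 4"
      by presburger+
    then show ?thesis by (simp add: \<epsilon>_def)
  next
    case 4
    then have "(1 - r) mod 6 = 4" "(1 + r) mod 6 = 4" "(- r) mod 6 = 3" "(r - 1) mod 6 = 2" "(r + 2) mod 6 = 5"
      by presburger+
    then show ?thesis by (simp add: \<epsilon>_def)
  next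
    case 5
    then have "(1 - r) mod 6 = 3" "(1 + r) mod 6 = 5" "(- r) mod 6 = 2" "(r - 1) mod 6 = 3" "(r + 2) mod 6 = 0"
      by presburger+
    then show ?thesis by (simp add: \<epsilon>_def)
  next
    case 6
    then have "(1 - r) mod 6 = 2" "(1 + r) mod 6 = 0" "(- r) mod 6 = 1" "(r - 1) mod 6 = 4" "(r + 2) mod 6 = 1"
      by presburger+
    then show ?thesis by (simp add: \<epsilon>_def)
  qed
  then show "\<epsilon> (1 - r) = - \<epsilon> (1 + r)" and "\<epsilon> (- r) = \<epsilon> (r - 1)" and "\<epsilon> (r + 2) = - \<epsilon> (r - 1)"
    by blast+
qed

text \<open>
  In what follows \<open>g\<^sup>3\<close> is the number \<open>q\<close> of the theorem: the base \<open>q\<^sup>4\<close> is \<open>(g\<^sup>6)\<^sup>2\<close>, and the exponents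
  \<open>(r\<^sup>2 + c r) / 3\<close> of \<open>q\<close> become integers.
\<close>

context
  fixes g :: complex
  assumes g: "g \<noteq> 0" "norm g < 1"
begin

lemma g6: "g ^ 6 \<noteq> 0" "norm (g ^ 6) < 1"
  using g by (auto simp: norm_power power_less_one_iff)

lemma powi_g6: "(g ^ 6) powi r * (c * g powi e) = c * g powi (6 * r + e)"
  using g by (simp add: power_int_add power_int_mult)

text \<open>
  In \<open>qsum_Suc_right\<close> the first part has the weight \<open>\<epsilon>(r + 1) g\<^bsup>r\<^sup>2-1\<^esup>\<close>, which is odd in \<open>r\<close>.  The second part is, after
  \<open>r \<mapsto> -r\<close>, a multiple of the sum for \<open>k\<close>.
\<close>

lemma qsum_middle: "qsum ((g ^ 6)\<^sup>2) (\<lambda>r. \<epsilon> r * g powi (r\<^sup>2 - 2 * r)) k = g ^ (3 * k\<^sup>2)"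
proof (induction k)
  case 0
  then show ?case by (simp add: \<epsilon>_def)
next
  case (Suc k)
  let ?A = "\<lambda>r. \<epsilon> r * g powi (r\<^sup>2 - 2 * r)"
  have "qsum ((g ^ 6)\<^sup>2) (\<lambda>r. ?A (r + 1)) k = 0"
  proof (rule qsum_odd)
    fix r :: int
    have "(- r + 1)\<^sup>2 - 2 * (- r + 1) = (r + 1)\<^sup>2 - 2 * (r + 1)"
      by (simp add: power2_eq_square algebra_simps)
    moreover have "\<epsilon> (- r + 1) = - \<epsilon> (r + 1)"
      using eps_symmetries(1)[of r] by (simp add: algebra_simps)
    ultimately show "?A (- r + 1) = - ?A (r + 1)" by (simp only: mult_minus_left)
  qed
  moreover have "qsum ((g ^ 6)\<^sup>2) (\<lambda>r. (g ^ 6) powi r * ?A (r - 1)) k = g ^ 3 * g ^ (3 * k\<^sup>2)"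
  proof -
    have "qsum ((g ^ 6)\<^sup>2) (\<lambda>r. (g ^ 6) powi r * ?A (r - 1)) k = qsum ((g ^ 6)\<^sup>2) (\<lambda>r. g ^ 3 * ?A (- r)) k"
    proof (rule qsum_cong)
      fix r :: int
      have e: "6 * r + ((r - 1)\<^sup>2 - 2 * (r - 1)) = 3 + ((- r)\<^sup>2 - 2 * (- r))"
        by (simp add: power2_eq_square algebra_simps)
      show "(g ^ 6) powi r * ?A (r - 1) = g ^ 3 * ?A (- r)"
        unfolding powi_g6 e eps_symmetries(2) using g by (subst power_int_add) auto
    qed
    also have "\<dots> = g ^ 3 * g ^ (3 * k\<^sup>2)"
      unfolding qsum_cmult qsum_reflect[of _ ?A] Suc.IH ..
    finally show ?thesis .
  qed
  moreover have "3 * (Suc k)\<^sup>2 = 6 * k + (3 + 3 * k\<^sup>2)"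
    by (simp add: power2_eq_square)
  ultimately show ?case
    unfolding qsum_Suc_right[OF g6] by (simp add: power_mult power_add)
qed

text \<open>
  Now the other recurrence is used: its twisted part is odd and vanishes, and the rest is \<open>qsum_middle\<close> reflected.
\<close>

lemma qsum_lower: "qsum ((g ^ 6)\<^sup>2) (\<lambda>r. \<epsilon> r * g powi (r\<^sup>2 + 4 * r)) k = g powi (3 * (int k)\<^sup>2 - 6 * int k)"
proof (cases k)
  case 0
  then show ?thesis by (simp add: \<epsilon>_def)
next
  case (Suc l)
  let ?A = "\<lambda>r. \<epsilon> r * g powi (r\<^sup>2 + 4 * r)"
  let ?B = "\<lambda>r. \<epsilon> r * g powi (r\<^sup>2 - 2 * r)"
  have "qsum ((g ^ 6)\<^sup>2) (\<lambda>r. (g ^ 6) powi (- r) * ?A (r + 1)) l = 0"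
  proof (rule qsum_odd)
    fix r :: int
    have e: "6 * (- r) + ((r + 1)\<^sup>2 + 4 * (r + 1)) = 6 * r + ((- r + 1)\<^sup>2 + 4 * (- r + 1))"
      by (simp add: power2_eq_square algebra_simps)
    have "\<epsilon> (- r + 1) = - \<epsilon> (r + 1)"
      using eps_symmetries(1)[of r] by (simp add: algebra_simps)
    then show "(g ^ 6) powi (- (- r)) * ?A (- r + 1) = - ((g ^ 6) powi (- r) * ?A (r + 1))"
      unfolding powi_g6 e by simp
  qed
  moreover have "qsum ((g ^ 6)\<^sup>2) (\<lambda>r. ?A (r - 1)) l = g powi (- 3) * g ^ (3 * l\<^sup>2)"
  proof -
    have "qsum ((g ^ 6)\<^sup>2) (\<lambda>r. ?A (r - 1)) l = qsum ((g ^ 6)\<^sup>2) (\<lambda>r. g powi (- 3) * ?B (- r)) l"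
    proof (rule qsum_cong)
      fix r :: int
      have e: "(r - 1)\<^sup>2 + 4 * (r - 1) = - 3 + ((- r)\<^sup>2 - 2 * (- r))"
        by (simp add: power2_eq_square algebra_simps)
      show "?A (r - 1) = g powi (- 3) * ?B (- r)"
        unfolding e eps_symmetries(2) using g by (subst power_int_add) auto
    qed
    also have "\<dots> = g powi (- 3) * g ^ (3 * l\<^sup>2)"
      unfolding qsum_cmult qsum_reflect[of _ ?B] qsum_middle ..
    finally show ?thesis .
  qed
  moreover have "g powi (3 * (int (Suc l))\<^sup>2 - 6 * int (Suc l)) = g powi (- 3) * g ^ (3 * l\<^sup>2)"
  proof -
    have e: "3 * (int (Suc l))\<^sup>2 - 6 * int (Suc l) = - 3 + int (3 * l\<^sup>2)"
      by (simp add: power2_eq_square algebra_simps)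
    show ?thesis
      unfolding e using g by (simp only: power_int_add power_int_of_nat simp_thms)
  qed
  ultimately show ?thesis
    unfolding Suc qsum_Suc_left[OF g6] by (simp only: mult_zero_right add_0_right)
qed

text \<open>
  The same recurrence, but here neither part vanishes: they reduce to \<open>qsum_middle\<close> and \<open>qsum_lower\<close>, which accounts
  for the two powers of \<open>g\<close>.
\<close>

lemma qsum_upper:
  "qsum ((g ^ 6)\<^sup>2) (\<lambda>r. \<epsilon> (r + 1) * g powi (r\<^sup>2 + 6 * r - 1)) k
     = g powi (3 * (int k)\<^sup>2 - 12 * int k + 3) - g powi (3 * (int k)\<^sup>2 + 3)"
proof (cases k)
  case 0
  then show ?thesis by (simp add: \<epsilon>_def)
next
  case (Suc l)
  let ?A = "\<lambda>r. \<epsilon> (r + 1) * g powi (r\<^sup>2 + 6 * r - 1)"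
  let ?B = "\<lambda>r. \<epsilon> r * g powi (r\<^sup>2 - 2 * r)"
  let ?C = "\<lambda>r. \<epsilon> r * g powi (r\<^sup>2 + 4 * r)"
  have 1: "qsum ((g ^ 6)\<^sup>2) (\<lambda>r. (g ^ 6) powi (- r) * ?A (r + 1)) l = - (g ^ 6) * g ^ (3 * l\<^sup>2)"
  proof -
    have "qsum ((g ^ 6)\<^sup>2) (\<lambda>r. (g ^ 6) powi (- r) * ?A (r + 1)) l
        = qsum ((g ^ 6)\<^sup>2) (\<lambda>r. - (g ^ 6) * ?B (- r)) l"
    proof (rule qsum_cong)
      fix r :: int
      have e: "6 * (- r) + ((r + 1)\<^sup>2 + 6 * (r + 1) - 1) = 6 + ((- r)\<^sup>2 - 2 * (- r))"
        by (simp add: power2_eq_square algebra_simps)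
      have e2: "r + 1 + 1 = r + 2" by simp
      show "(g ^ 6) powi (- r) * ?A (r + 1) = - (g ^ 6) * ?B (- r)"
        unfolding powi_g6 e e2 eps_symmetries(2) eps_symmetries(3) using g by (subst power_int_add) auto
    qed
    also have "\<dots> = - (g ^ 6) * g ^ (3 * l\<^sup>2)"
      unfolding qsum_cmult qsum_reflect[of _ ?B] qsum_middle ..
    finally show ?thesis .
  qed
  have 2: "qsum ((g ^ 6)\<^sup>2) (\<lambda>r. ?A (r - 1)) l = g powi (- 6) * g powi (3 * (int l)\<^sup>2 - 6 * int l)"
  proof -
    have "qsum ((g ^ 6)\<^sup>2) (\<lambda>r. ?A (r - 1)) l = qsum ((g ^ 6)\<^sup>2) (\<lambda>r. g powi (- 6) * ?C r) l"
    proof (rule qsum_cong)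
      fix r :: int
      have e: "(r - 1)\<^sup>2 + 6 * (r - 1) - 1 = - 6 + (r\<^sup>2 + 4 * r)"
        by (simp add: power2_eq_square algebra_simps)
      show "?A (r - 1) = g powi (- 6) * ?C r"
        unfolding e using g by (subst power_int_add) auto
    qed
    then show ?thesis
      unfolding qsum_cmult qsum_lower .
  qed
  have e1: "3 * (int (Suc l))\<^sup>2 - 12 * int (Suc l) + 3 = - 6 + (3 * (int l)\<^sup>2 - 6 * int l)"
    and e2: "3 * (int (Suc l))\<^sup>2 + 3 = int (6 * l + 6 + 3 * l\<^sup>2)"
    by (simp_all add: power2_eq_square algebra_simps)
  have "g powi (3 * (int (Suc l))\<^sup>2 + 3) = (g ^ 6) ^ l * (g ^ 6 * g ^ (3 * l\<^sup>2))"
    unfolding e2 power_int_of_nat by (simp add: power_add power_mult)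
  moreover have "g powi (3 * (int (Suc l))\<^sup>2 - 12 * int (Suc l) + 3)
      = g powi (- 6) * g powi (3 * (int l)\<^sup>2 - 6 * int l)"
    unfolding e1 using g by (subst power_int_add) auto
  ultimately show ?thesis
    unfolding Suc qsum_Suc_left[OF g6] 1 2 by simp
qed

end

section \<open>Theta series\<close>

lemma abs_summable_on_Times:
  fixes f :: "'a \<Rightarrow> 'c :: real_normed_div_algebra" and g :: "'b \<Rightarrow> 'c"
  assumes "(\<lambda>a. norm (f a)) summable_on A" "(\<lambda>b. norm (g b)) summable_on B"
  shows "(\<lambda>p. norm (case p of (a, b) \<Rightarrow> f a * g b)) summable_on A \<times> B"
proof (rule summable_on_SigmaI)
  show "((\<lambda>b. norm (case (a, b) of (a, b) \<Rightarrow> f a * g b)) has_sum norm (f a) * infsum (\<lambda>b. norm (g b)) B) B" for a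
    unfolding split norm_mult using assms(2) by (intro has_sum_cmult_right has_sum_infsum)
  show "(\<lambda>a. norm (f a) * infsum (\<lambda>b. norm (g b)) B) summable_on A"
    using assms(1) by (rule summable_on_cmult_left)
qed auto

text \<open>
  Pairs \<open>(a, b)\<close> of natural numbers are sorted by their difference \<open>r = a - b\<close> and their minimum \<open>m\<close>.
\<close>

lemma bij_betw_diff_min:
  "bij_betw (\<lambda>(r :: int, m :: nat). (m + nat r, m + nat (- r))) UNIV UNIV"
  by (rule bij_betw_byWitness[where f' = "\<lambda>(a, b). (int a - int b, min a b)"]) auto

text \<open>
  The product of the Euler series for \<open>w\<close> and \<open>1 / w\<close> is a double series over \<open>(a, b)\<close>.  Collecting the terms
  with \<open>a - b = r\<close>, the coefficient of \<open>w\<^sup>r\<close> is \<open>y\<^bsup>r\<^sup>2\<^esup>\<close> times a Durfee sum, which does not depend on \<open>r\<close>.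
\<close>

theorem jacobi_triple_product:
  fixes y w :: complex
  assumes "norm y < 1" "y \<noteq> 0" "w \<noteq> 0"
  shows "((\<lambda>r :: int. y powi r\<^sup>2 * w powi r) has_sum
           (qpoch_inf (- y * w) (y\<^sup>2) * qpoch_inf (- y / w) (y\<^sup>2) * qpoch_inf (y\<^sup>2) (y\<^sup>2))) UNIV"
proof -
  define Q where "Q = y\<^sup>2"
  have Q: "norm Q < 1" using assms by (simp add: Q_def norm_power abs_square_less_1)
  note nz = qpoch_inf_nonzero[OF Q Q]
  define e where "e w a = y ^ a\<^sup>2 * w ^ a / qpoch Q Q a" for w a
  let ?P = "qpoch_inf (- y * w) Q * qpoch_inf (- y / w) Q"
  have abs: "(\<lambda>a. norm (e w a)) summable_on UNIV" for w
    using euler_summable[OF assms(1), of w] by (simp add: e_def[abs_def] Q_def summable_on_UNIV_nonneg_real_iff)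
  have e_sum: "(e w has_sum qpoch_inf (- y * w) Q) UNIV" for w
    using euler_has_sum[OF assms(1), of w] by (simp add: e_def[abs_def] Q_def)
  have "(\<lambda>(a, b). e w a * e (1 / w) b) summable_on UNIV \<times> UNIV"
    using abs_summable_summable[OF abs_summable_on_Times[OF abs abs]] .
  then have "((\<lambda>(a, b). e w a * e (1 / w) b) has_sum ?P) (UNIV \<times> UNIV)"
    using e_sum[of w] e_sum[of "1 / w"]
    by (intro has_sum_SigmaI[where g = "\<lambda>a. e w a * qpoch_inf (- y / w) Q"])
       (auto intro!: has_sum_cmult_right has_sum_cmult_left)
  then have "((\<lambda>(r, m). e w (m + nat r) * e (1 / w) (m + nat (- r))) has_sum ?P) UNIV"
    using has_sum_reindex_bij_betw[OF bij_betw_diff_min, of "\<lambda>(a, b). e w a * e (1 / w) b" ?P]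
    by (simp add: case_prod_unfold)
  then have "((\<lambda>(r, m). e w (m + nat r) * e (1 / w) (m + nat (- r))) has_sum ?P) (UNIV \<times> UNIV)"
    by simp
  then have "((\<lambda>r. y powi r\<^sup>2 * w powi r * (1 / qpoch_inf Q Q)) has_sum ?P) UNIV"
  proof (rule has_sum_SigmaD)
    fix r :: int
    define R where "R = nat \<bar>r\<bar>"
    have "e w (m + nat r) * e (1 / w) (m + nat (- r))
        = y powi r\<^sup>2 * w powi r * (Q ^ (m\<^sup>2 + m * R) / (qpoch Q Q m * qpoch Q Q (m + R)))" for m
    proof -
      \<comment> \<open>The larger of \<open>a, b\<close> is \<open>m + R\<close>, the smaller is \<open>m\<close>.\<close>
      have y: "y ^ (m + R)\<^sup>2 * y ^ m\<^sup>2 = y powi r\<^sup>2 * Q ^ (m\<^sup>2 + m * R)"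
      proof -
        have "r\<^sup>2 = int (R\<^sup>2)" by (simp add: R_def)
        then have "y powi r\<^sup>2 = y ^ R\<^sup>2" by (simp only: power_int_of_nat)
        moreover have "(m + R)\<^sup>2 + m\<^sup>2 = R\<^sup>2 + 2 * (m\<^sup>2 + m * R)"
          by (simp add: power2_eq_square algebra_simps)
        ultimately show ?thesis
          by (simp only: Q_def flip: power_add power_mult)
      qed
      show ?thesis
      proof (cases "r \<ge> 0")
        case True
        then have r: "nat r = R" "nat (- r) = 0" "r = int R" by (auto simp: R_def)
        have "e w (m + nat r) * e (1 / w) (m + nat (- r))
            = (y ^ (m + R)\<^sup>2 * y ^ m\<^sup>2) * (w ^ (m + R) * (1 / w) ^ m) / (qpoch Q Q m * qpoch Q Q (m + R))"
          unfolding e_def r(1,2) by (simp add: mult_ac)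
        also have "w ^ (m + R) * (1 / w) ^ m = w powi r"
          using assms(3) by (simp add: r(3) power_add power_one_over)
        finally show ?thesis unfolding y by simp
      next
        case False
        then have r: "nat r = 0" "nat (- r) = R" "r = - int R" by (auto simp: R_def)
        have "e w (m + nat r) * e (1 / w) (m + nat (- r))
            = (y ^ (m + R)\<^sup>2 * y ^ m\<^sup>2) * (w ^ m * (1 / w) ^ (m + R)) / (qpoch Q Q m * qpoch Q Q (m + R))"
          unfolding e_def r(1,2) by (simp add: mult_ac)
        also have "w ^ m * (1 / w) ^ (m + R) = w powi r"
          using assms(3) by (simp add: r(3) power_add power_one_over power_int_minus field_simps)
        finally show ?thesis unfolding y by simp
      qed
    qed
    then show "((\<lambda>m. case (r, m) of (r, m) \<Rightarrow> e w (m + nat r) * e (1 / w) (m + nat (- r))) has_sum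
          y powi r\<^sup>2 * w powi r * (1 / qpoch_inf Q Q)) UNIV"
      unfolding split by (simp only:) (intro has_sum_cmult_right durfee_has_sum Q)
  qed
  then have "((\<lambda>r. y powi r\<^sup>2 * w powi r * (1 / qpoch_inf Q Q) * qpoch_inf Q Q) has_sum ?P * qpoch_inf Q Q) UNIV"
    by (rule has_sum_cmult_left)
  then show ?thesis using nz by (simp add: Q_def)
qed

text \<open>
  The exponents of \<open>q\<close> in the factors are sorted by their residue modulo \<open>n\<close>.
\<close>

lemma qpoch_inf_multisection:
  assumes "norm q < 1" "n > 0"
  shows "qpoch_inf a q = (\<Prod>i<n. qpoch_inf (a * q ^ i) (q ^ n))"
proof -
  have qn: "norm (q ^ n) < 1" using assms by (simp add: norm_power power_less_one_iff)
  have "(\<lambda>N. qpoch a q (N * n)) \<longlonglongrightarrow> qpoch_inf a q"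
    using assms(2) by (intro filterlim_compose[OF qpoch_LIMSEQ[OF assms(1)]] mult_nat_right_at_top) auto
  moreover have "qpoch a q (N * n) = (\<Prod>i<n. qpoch (a * q ^ i) (q ^ n) N)" for N
  proof -
    have "qpoch a q (N * n) = (\<Prod>m<N. \<Prod>i<n. 1 - a * q ^ (m * n + i))"
      unfolding qpoch_def
    proof (induction N)
      case (Suc N)
      have split: "(\<Prod>k<M + j. 1 - a * q ^ k) = (\<Prod>k<M. 1 - a * q ^ k) * (\<Prod>i<j. 1 - a * q ^ (M + i))" for M j
        by (induction j) (simp_all add: mult_ac)
      have "(\<Prod>k<Suc N * n. 1 - a * q ^ k) = (\<Prod>k<N * n + n. 1 - a * q ^ k)"
        by (simp add: add.commute)
      also have "\<dots> = (\<Prod>k<N * n. 1 - a * q ^ k) * (\<Prod>i<n. 1 - a * q ^ (N * n + i))"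
        by (rule split)
      finally show ?case using Suc by simp
    qed simp
    also have "\<dots> = (\<Prod>i<n. \<Prod>m<N. 1 - a * q ^ (m * n + i))"
      by (rule prod.swap)
    moreover have e: "q ^ (m * n + i) = q ^ i * (q ^ n) ^ m" for m i
      by (simp add: power_add mult.commute flip: power_mult)
    ultimately show ?thesis
      unfolding qpoch_def by (simp only: mult.assoc)
  qed
  moreover have "(\<lambda>N. \<Prod>i<n. qpoch (a * q ^ i) (q ^ n) N) \<longlonglongrightarrow> (\<Prod>i<n. qpoch_inf (a * q ^ i) (q ^ n))"
    by (intro tendsto_prod qpoch_LIMSEQ qn)
  ultimately show ?thesis using LIMSEQ_unique by simp
qed

text \<open>
  The triple product with base \<open>y\<^bsup>36\<^esup>\<close>, whose three factors are the trisection of \<open>(y\<^bsup>12\<^esup>;y\<^bsup>12\<^esup>)\<^sub>\<infinity>\<close>.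
\<close>

lemma pentagonal_number_series:
  fixes y :: complex
  assumes "norm y < 1" "y \<noteq> 0"
  shows "((\<lambda>n :: int. (- 1) powi n * y powi (18 * n\<^sup>2 - 6 * n)) has_sum qpoch_inf (y ^ 12) (y ^ 12)) UNIV"
proof -
  have y18: "norm (y ^ 18) < 1" "norm (y ^ 12) < 1" using assms by (simp_all add: norm_power power_less_one_iff)
  have *: "- (y ^ 18) * (- (y powi (- 6))) = y ^ 12" "- (y ^ 18) / (- (y powi (- 6))) = y ^ 24"
    using assms by (simp_all add: power_int_minus field_simps flip: power_add)
  have "((\<lambda>r :: int. (y ^ 18) powi r\<^sup>2 * (- (y powi (- 6))) powi r) has_sum
           (qpoch_inf (y ^ 12) (y ^ 36) * qpoch_inf (y ^ 24) (y ^ 36) * qpoch_inf (y ^ 36) (y ^ 36))) UNIV"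
    using jacobi_triple_product[OF y18(1), of "- (y powi (- 6))"] assms
    unfolding * by (simp flip: power_mult)
  moreover have "qpoch_inf (y ^ 12) (y ^ 36) * qpoch_inf (y ^ 24) (y ^ 36) * qpoch_inf (y ^ 36) (y ^ 36)
      = qpoch_inf (y ^ 12) (y ^ 12)"
    using qpoch_inf_multisection[OF y18(2), of 3 "y ^ 12"]
    by (simp add: lessThan_nat_numeral mult_ac flip: power_mult power_add)
  moreover have "(y ^ 18) powi r\<^sup>2 * (- (y powi (- 6))) powi r = (- 1) powi r * y powi (18 * r\<^sup>2 - 6 * r)" for r
  proof -
    have "(- (y powi (- 6))) powi r = (- 1) powi r * (y powi (- 6)) powi r"
      by (metis mult_minus1 power_int_mult_distrib)
    moreover have "(y powi (- 6)) powi r = y powi (- 6 * r)"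
      by (rule power_int_mult[symmetric])
    moreover have "(y ^ 18) powi r\<^sup>2 = y powi (18 * r\<^sup>2)"
      by (simp add: power_int_mult)
    moreover have "y powi (18 * r\<^sup>2 - 6 * r) = y powi (18 * r\<^sup>2) * y powi (- 6 * r)"
      using assms by (subst power_int_add[symmetric]) auto
    ultimately show ?thesis by simp
  qed
  ultimately show ?thesis by simp
qed

text \<open>
  Used to split the quintuple product series by the residue of \<open>r\<close> modulo \<open>3\<close>.
\<close>

lemma eps_mod3:
  shows "\<epsilon> (3 * s) = (- 1) powi s" and "\<epsilon> (3 * s - 1) = (- 1) powi s" and "\<epsilon> (3 * s + 1) = 0"
proof -
  have "\<epsilon> (3 * s) = (- 1) powi s \<and> \<epsilon> (3 * s - 1) = (- 1) powi s \<and> \<epsilon> (3 * s + 1) = 0"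
  proof (cases "even s")
    case True
    then have "(3 * s) mod 6 = 0" "(3 * s - 1) mod 6 = 5" "(3 * s + 1) mod 6 = 1" by presburger+
    then show ?thesis using True by (simp add: \<epsilon>_def power_int_minus_left)
  next
    case False
    then have "(3 * s) mod 6 = 3" "(3 * s - 1) mod 6 = 2" "(3 * s + 1) mod 6 = 4" by presburger+
    then show ?thesis using False by (simp add: \<epsilon>_def power_int_minus_left)
  qed
  then show "\<epsilon> (3 * s) = (- 1) powi s" and "\<epsilon> (3 * s - 1) = (- 1) powi s" and "\<epsilon> (3 * s + 1) = 0"
    by blast+
qed

text \<open>
  The right-hand side, multiplied by \<open>(y\<^bsup>12\<^esup>;y\<^bsup>12\<^esup>)\<^sub>\<infinity>\<close>, is a product of two theta series \<open>\<Sum> h(m)\<close> and \<open>\<Sum> k(n)\<close>.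
  With \<open>m = 2n - r\<close> the coefficient of \<open>w\<^sup>r\<close> is a quadratic exponential sum over \<open>n\<close>.  Completing the square shifts
  \<open>n\<close> by about \<open>r / 3\<close>: for \<open>r \<equiv> 0, 2 (mod 3)\<close> this leaves the pentagonal number series
  \<open>(y\<^bsup>12\<^esup>;y\<^bsup>12\<^esup>)\<^sub>\<infinity>\<close>, and for \<open>r \<equiv> 1\<close> a sum that is cancelled by a reflection of \<open>n\<close>.
\<close>

theorem quintuple_product:
  fixes y w :: complex
  assumes y: "norm y < 1" "y \<noteq> 0" and w: "w \<noteq> 0"
  shows "((\<lambda>r. \<epsilon> r * y powi r\<^sup>2 * w powi r) has_sum
           (qpoch_inf (- y / w) (y ^ 6) * qpoch_inf (- (y ^ 5) * w) (y ^ 6) * qpoch_inf (y ^ 6) (y ^ 6)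
            * qpoch_inf (y ^ 4 * w\<^sup>2) (y ^ 12) * qpoch_inf (y ^ 8 / w\<^sup>2) (y ^ 12))) UNIV"
proof -
  have yn: "norm (y ^ 3) < 1" "norm (y ^ 6) < 1" "norm (y ^ 12) < 1"
    using y by (simp_all add: norm_power power_less_one_iff)
  note nz = qpoch_inf_nonzero[OF yn(3) yn(3)]
  \<comment> \<open>Chosen so that Jacobi's identity with \<open>(y\<^sup>3, u)\<close> and \<open>(y\<^sup>6, v)\<close> gives the factors with base \<open>y\<^sup>6\<close> and \<open>y\<^bsup>12\<^esup>\<close>.\<close>
  define u where "u = 1 / (y\<^sup>2 * w)"
  define v where "v = - (w\<^sup>2 / y\<^sup>2)"
  define h where "h m = (y ^ 3) powi m\<^sup>2 * u powi m" for m :: int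
  define k where "k n = (y ^ 6) powi n\<^sup>2 * v powi n" for n :: int
  define H where "H = qpoch_inf (- y / w) (y ^ 6) * qpoch_inf (- (y ^ 5) * w) (y ^ 6) * qpoch_inf (y ^ 6) (y ^ 6)"
  define K where "K = qpoch_inf (y ^ 4 * w\<^sup>2) (y ^ 12) * qpoch_inf (y ^ 8 / w\<^sup>2) (y ^ 12)"
  have uv: "u \<noteq> 0" "v \<noteq> 0" using y w by (auto simp: u_def v_def)
  have "- (y ^ 3) * u = - y / w" "- (y ^ 3) / u = - (y ^ 5) * w" "(y ^ 3)\<^sup>2 = y ^ 6"
    using y w by (simp_all add: u_def field_simps eval_nat_numeral)
  then have h_sum: "(h has_sum H) UNIV"
    using jacobi_triple_product[OF yn(1) _ uv(1)] y by (simp add: h_def[abs_def] H_def)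
  have "- (y ^ 6) * v = y ^ 4 * w\<^sup>2" "- (y ^ 6) / v = y ^ 8 / w\<^sup>2" "(y ^ 6)\<^sup>2 = y ^ 12"
    using y w by (simp_all add: v_def field_simps eval_nat_numeral)
  then have k_sum: "(k has_sum (K * qpoch_inf (y ^ 12) (y ^ 12))) UNIV"
    using jacobi_triple_product[OF yn(2) _ uv(2)] y by (simp add: k_def[abs_def] K_def)
  have abs: "(\<lambda>m. norm (h m)) summable_on UNIV" "(\<lambda>n. norm (k n)) summable_on UNIV"
    using has_sum_imp_summable[OF h_sum] has_sum_imp_summable[OF k_sum]
    by (simp_all flip: summable_on_iff_abs_summable_on_complex)
  let ?S = "H * (K * qpoch_inf (y ^ 12) (y ^ 12))"
  have "((\<lambda>(m, n). h m * k n) has_sum ?S) (UNIV \<times> UNIV)"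
    using h_sum k_sum abs_summable_summable[OF abs_summable_on_Times[OF abs]]
    by (intro has_sum_SigmaI[where g = "\<lambda>m. h m * (K * qpoch_inf (y ^ 12) (y ^ 12))"])
       (auto intro!: has_sum_cmult_right has_sum_cmult_left)
  moreover have "bij_betw (\<lambda>(r :: int, n :: int). (2 * n - r, n)) (UNIV \<times> UNIV) (UNIV \<times> UNIV)"
    by (rule bij_betw_byWitness[where f' = "\<lambda>(m, n). (2 * n - m, n)"]) auto
  ultimately have "((\<lambda>p. case (case p of (r, n) \<Rightarrow> (2 * n - r, n)) of (m, n) \<Rightarrow> h m * k n) has_sum ?S) (UNIV \<times> UNIV)"
    by (subst has_sum_reindex_bij_betw)
  then have hk: "((\<lambda>(r, n). h (2 * n - r) * k n) has_sum ?S) (UNIV \<times> UNIV)"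
    by (simp add: case_prod_unfold)
  have hk_eq: "h (2 * n - r) * k n = w powi r * ((- 1) powi n * y powi (18 * n\<^sup>2 - 12 * n * r - 6 * n + 3 * r\<^sup>2 + 2 * r))" for n r
  proof -
    have "(y ^ 3) powi (2 * n - r)\<^sup>2 = y powi (3 * (2 * n - r)\<^sup>2)" "(y ^ 6) powi n\<^sup>2 = y powi (6 * n\<^sup>2)"
      by (simp_all add: power_int_mult)
    moreover have "u powi (2 * n - r) = y powi (- 2 * (2 * n - r)) * w powi (r - 2 * n)"
    proof -
      have "u powi (2 * n - r) = (y powi (- 2) * w powi (- 1)) powi (2 * n - r)"
        by (simp add: u_def power_int_minus field_simps)
      also have "\<dots> = y powi (- 2 * (2 * n - r)) * w powi (- 1 * (2 * n - r))"
        unfolding power_int_mult_distrib power_int_mult ..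
      finally show ?thesis by (simp add: algebra_simps)
    qed
    moreover have "v powi n = (- 1) powi n * (w powi (2 * n) * y powi (- 2 * n))"
    proof -
      have "v powi n = (- 1 * (w powi 2 * y powi (- 2))) powi n"
        by (simp add: v_def power_int_minus field_simps)
      also have "\<dots> = (- 1) powi n * (w powi (2 * n) * y powi (- 2 * n))"
        unfolding power_int_mult_distrib power_int_mult ..
      finally show ?thesis .
    qed
    ultimately have "h (2 * n - r) * k n
      = (- 1) powi n * (y powi (3 * (2 * n - r)\<^sup>2) * y powi (- 2 * (2 * n - r)) * y powi (6 * n\<^sup>2) * y powi (- 2 * n))
         * (w powi (r - 2 * n) * w powi (2 * n))"
      unfolding h_def k_def by (simp only: mult_ac)
    also have "w powi (r - 2 * n) * w powi (2 * n) = w powi r"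
      using w by (simp flip: power_int_add)
    also have "y powi (3 * (2 * n - r)\<^sup>2) * y powi (- 2 * (2 * n - r)) * y powi (6 * n\<^sup>2) * y powi (- 2 * n)
        = y powi (3 * (2 * n - r)\<^sup>2 + - 2 * (2 * n - r) + 6 * n\<^sup>2 + - 2 * n)"
      using y by (simp only: power_int_add simp_thms)
    also have "3 * (2 * n - r)\<^sup>2 + - 2 * (2 * n - r) + 6 * n\<^sup>2 + - 2 * n
        = 18 * n\<^sup>2 - 12 * n * r - 6 * n + 3 * r\<^sup>2 + 2 * r"
      by (simp add: power2_eq_square algebra_simps)
    finally show ?thesis by (simp only: mult_ac)
  qed
  have inner: "((\<lambda>n. h (2 * n - r) * k n) has_sum
                 \<epsilon> r * y powi r\<^sup>2 * w powi r * qpoch_inf (y ^ 12) (y ^ 12)) UNIV" for r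
  proof -
    define f where "f n = (- 1) powi n * y powi (18 * n\<^sup>2 - 12 * n * r - 6 * n + 3 * r\<^sup>2 + 2 * r)" for n
    define p where "p n = (- 1) powi n * y powi (18 * n\<^sup>2 - 6 * n)" for n :: int
    have p_sum: "(p has_sum qpoch_inf (y ^ 12) (y ^ 12)) UNIV"
      using pentagonal_number_series[OF y] by (simp add: p_def[abs_def])
    have "(f has_sum \<epsilon> r * y powi r\<^sup>2 * qpoch_inf (y ^ 12) (y ^ 12)) UNIV"
    proof -
      have "r mod 3 \<in> {0..<3}" by simp
      then consider "r mod 3 = 0" | "r mod 3 = 1" | "r mod 3 = 2" by force
      then show ?thesis
      proof cases
        case 1
        then obtain s where r: "r = 3 * s" by (metis mod_0_imp_dvd dvd_def)
        have "f (n + s) = \<epsilon> r * y powi r\<^sup>2 * p n" for n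
        proof -
          have e: "18 * (n + s)\<^sup>2 - 12 * (n + s) * r - 6 * (n + s) + 3 * r\<^sup>2 + 2 * r = r\<^sup>2 + (18 * n\<^sup>2 - 6 * n)"
            by (simp add: r power2_eq_square algebra_simps)
          have e': "y powi (r\<^sup>2 + (18 * n\<^sup>2 - 6 * n)) = y powi r\<^sup>2 * y powi (18 * n\<^sup>2 - 6 * n)"
            using y by (intro power_int_add) auto
          have sgn: "(- 1) powi (n + s) = \<epsilon> r * (- 1) powi n"
            by (simp add: power_int_add r eps_mod3)
          show ?thesis
            unfolding f_def p_def e e' sgn by (simp only: mult_ac)
        qed
        then have "((\<lambda>n. f (n + s)) has_sum \<epsilon> r * y powi r\<^sup>2 * qpoch_inf (y ^ 12) (y ^ 12)) UNIV"
          by (simp only:) (intro has_sum_cmult_right p_sum)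
        moreover have "bij_betw (\<lambda>n :: int. n + s) UNIV UNIV"
          by (rule bij_betw_byWitness[where f' = "\<lambda>n. n - s"]) auto
        ultimately show ?thesis by (subst (asm) has_sum_reindex_bij_betw)
      next
        case 3
        then have "r = 3 * (r div 3 + 1) - 1" using div_mult_mod_eq[of r 3] by simp
        then obtain s where r: "r = 3 * s - 1" by blast
        have "f (s - n) = \<epsilon> r * y powi r\<^sup>2 * p n" for n
        proof -
          have e: "18 * (s - n)\<^sup>2 - 12 * (s - n) * r - 6 * (s - n) + 3 * r\<^sup>2 + 2 * r = r\<^sup>2 + (18 * n\<^sup>2 - 6 * n)"
            by (simp add: r power2_eq_square algebra_simps)
          have e': "y powi (r\<^sup>2 + (18 * n\<^sup>2 - 6 * n)) = y powi r\<^sup>2 * y powi (18 * n\<^sup>2 - 6 * n)"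
            using y by (intro power_int_add) auto
          have sgn: "(- 1) powi (s - n) = \<epsilon> r * (- 1) powi n"
            by (auto simp: power_int_minus_left r eps_mod3)
          show ?thesis
            unfolding f_def p_def e e' sgn by (simp only: mult_ac)
        qed
        then have "((\<lambda>n. f (s - n)) has_sum \<epsilon> r * y powi r\<^sup>2 * qpoch_inf (y ^ 12) (y ^ 12)) UNIV"
          by (simp only:) (intro has_sum_cmult_right p_sum)
        moreover have "bij_betw (\<lambda>n :: int. s - n) UNIV UNIV"
          by (rule bij_betw_byWitness[where f' = "\<lambda>n. s - n"]) auto
        ultimately show ?thesis by (subst (asm) has_sum_reindex_bij_betw)
      next
        case 2
        then obtain s where r: "r = 3 * s + 1"
          by (metis mult_div_mod_eq)
        have "(\<lambda>n. h (2 * n - r) * k n) summable_on UNIV"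
          using summable_on_SigmaD1[of "\<lambda>r n. h (2 * n - r) * k n" UNIV "\<lambda>_. UNIV" r] has_sum_imp_summable[OF hk]
          by simp
        then have "f summable_on UNIV"
          using w unfolding hk_eq by (subst (asm) summable_on_cmult_right') (auto simp: f_def[abs_def])
        then obtain t where t: "(f has_sum t) UNIV" by (auto simp: summable_on_def)
        \<comment> \<open>The exponent is symmetric under \<open>n \<mapsto> 2s + 1 - n\<close>, the sign changes.\<close>
        have "f (2 * s + 1 - n) = - 1 * f n" for n
        proof -
          have e: "18 * (2 * s + 1 - n)\<^sup>2 - 12 * (2 * s + 1 - n) * r - 6 * (2 * s + 1 - n) + 3 * r\<^sup>2 + 2 * r
              = 18 * n\<^sup>2 - 12 * n * r - 6 * n + 3 * r\<^sup>2 + 2 * r"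
            by (simp add: r power2_eq_square algebra_simps)
          have sgn: "(- 1 :: complex) powi (2 * s + 1 - n) = - ((- 1) powi n)"
            by (auto simp: power_int_minus_left)
          show ?thesis
            unfolding f_def e sgn by (simp only: mult_minus_left mult_1_left)
        qed
        moreover have "((\<lambda>n. f (2 * s + 1 - n)) has_sum t) UNIV"
        proof -
          have "bij_betw (\<lambda>n :: int. 2 * s + 1 - n) UNIV UNIV"
            by (rule bij_betw_byWitness[where f' = "\<lambda>n. 2 * s + 1 - n"]) auto
          then show ?thesis using t by (subst has_sum_reindex_bij_betw)
        qed
        ultimately have "((\<lambda>n. - 1 * f n) has_sum t) UNIV" by (simp only:)
        moreover have "((\<lambda>n. - 1 * f n) has_sum - 1 * t) UNIV" by (intro has_sum_cmult_right t)
        ultimately have "t = - 1 * t" by (rule has_sum_unique)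
        then show ?thesis using t by (simp add: r eps_mod3)
      qed
    qed
    then have "((\<lambda>n. w powi r * f n) has_sum w powi r * (\<epsilon> r * y powi r\<^sup>2 * qpoch_inf (y ^ 12) (y ^ 12))) UNIV"
      by (rule has_sum_cmult_right)
    then show ?thesis unfolding hk_eq f_def by (simp add: mult_ac)
  qed
  have "((\<lambda>r. \<epsilon> r * y powi r\<^sup>2 * w powi r * qpoch_inf (y ^ 12) (y ^ 12)) has_sum ?S) UNIV"
    by (rule has_sum_SigmaD[OF hk]) (use inner in auto)
  then have "((\<lambda>r. \<epsilon> r * y powi r\<^sup>2 * w powi r * qpoch_inf (y ^ 12) (y ^ 12) * (1 / qpoch_inf (y ^ 12) (y ^ 12)))
               has_sum ?S * (1 / qpoch_inf (y ^ 12) (y ^ 12))) UNIV"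
    by (rule has_sum_cmult_left)
  then show ?thesis
    using nz by (simp add: H_def K_def mult_ac)
qed

section \<open>The Bailey transform\<close>

lemma square_plus_square_ge:
  fixes j k :: nat
  shows "j + k \<le> (2 * j + k)\<^sup>2 + k\<^sup>2"
proof -
  have "2 * j + k \<le> (2 * j + k)\<^sup>2" by (simp add: power2_eq_square)
  then show ?thesis by linarith
qed

text \<open>
  Put \<open>n = j + m\<close>.  The inner sum over \<open>m \<le> n\<close> is the \<open>q\<close>-Vandermonde sum, which leaves the Durfee sum over \<open>n\<close>.
  In the Bailey chain this is the step that carries a pair to the next pair, followed by the limit.
\<close>

lemma bailey_step:
  fixes q :: complex
  assumes q: "norm q < 1"
  shows "((\<lambda>(j, m). q ^ ((j + m)\<^sup>2 + (j + m) * r) * q ^ (m\<^sup>2 + m * r)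
             / (qpoch q q j * qpoch q q m * qpoch q q (m + r))) has_sum (1 / qpoch_inf q q)) UNIV"
    (is "(?F has_sum _) UNIV")
proof -
  note nz = qpoch_nonzero[OF q q]
  obtain K where K: "K > 0" "\<And>n. norm (1 / qpoch q q n) \<le> K"
    using inverse_qpoch_bounded[OF q q] by blast
  have geo: "(\<lambda>n. norm (norm q ^ n)) summable_on UNIV"
    using q by (simp add: summable_on_UNIV_nonneg_real_iff summable_geometric)
  have "(\<lambda>p. norm (?F p)) summable_on UNIV"
  proof (rule summable_on_comparison_test)
    show "(\<lambda>p. norm (case p of (j, m) \<Rightarrow> norm q ^ j * norm q ^ m) * (K * K * K)) summable_on UNIV"
      using summable_on_cmult_left[OF abs_summable_on_Times[OF geo geo]] by simp
    fix p :: "nat \<times> nat"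
    obtain j m where p: "p = (j, m)" by force
    have "norm (?F p) = norm q ^ ((j + m)\<^sup>2 + (j + m) * r + (m\<^sup>2 + m * r))
        * (norm (1 / qpoch q q j) * norm (1 / qpoch q q m) * norm (1 / qpoch q q (m + r)))"
      by (simp add: p norm_mult norm_divide norm_power power_add)
    also have "\<dots> \<le> norm q ^ (j + m) * (K * K * K)"
    proof -
      have "j + m \<le> (j + m)\<^sup>2 + (j + m) * r + (m\<^sup>2 + m * r)"
        using le_square[of "j + m"] unfolding power2_eq_square by linarith
      then show ?thesis
        using q K by (intro mult_mono power_decreasing) (auto intro!: mult_nonneg_nonneg)
    qed
    finally show "norm (?F p) \<le> norm (case p of (j, m) \<Rightarrow> norm q ^ j * norm q ^ m) * (K * K * K)"
      by (simp add: p power_add)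
  qed auto
  then have F: "?F summable_on UNIV" by (rule abs_summable_summable)
  have bij: "bij_betw (\<lambda>(n, m). (n - m, m)) (SIGMA n : UNIV. {..n}) (UNIV :: (nat \<times> nat) set)"
    by (rule bij_betw_byWitness[where f' = "\<lambda>(j, m). (j + m, m)"]) auto
  let ?G = "\<lambda>(n, m). q ^ (n\<^sup>2 + n * r) * q ^ (m\<^sup>2 + m * r)
             / (qpoch q q (n - m) * qpoch q q m * qpoch q q (m + r))"
  have G: "?G p = ?F (case p of (n, m) \<Rightarrow> (n - m, m))" if "p \<in> (SIGMA n : UNIV. {..n})" for p
    using that by auto
  have "(?G has_sum (1 / qpoch_inf q q)) (SIGMA n : UNIV. {..n})"
  proof (rule has_sum_SigmaI)
    fix n
    have "(\<Sum>m\<le>n. ?G (n, m)) = q ^ (n\<^sup>2 + n * r) / qpoch q q n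
             * (\<Sum>m\<le>n. qbinom q n m * q ^ (m\<^sup>2 + m * r) / qpoch q q (m + r))"
      unfolding sum_distrib_left by (rule sum.cong) (use nz in \<open>auto simp: qbinom_def\<close>)
    also have "\<dots> = q ^ (n\<^sup>2 + n * r) / (qpoch q q n * qpoch q q (n + r))"
      unfolding q_vandermonde[OF q] by simp
    finally show "((\<lambda>m. ?G (n, m)) has_sum q ^ (n\<^sup>2 + n * r) / (qpoch q q n * qpoch q q (n + r))) {..n}"
      using has_sum_finite[of "{..n}" "\<lambda>m. ?G (n, m)"] by simp
  next
    show "((\<lambda>n. q ^ (n\<^sup>2 + n * r) / (qpoch q q n * qpoch q q (n + r))) has_sum 1 / qpoch_inf q q) UNIV"
      by (rule durfee_has_sum[OF q])
    have "(\<lambda>p. ?F (case p of (n, m) \<Rightarrow> (n - m, m))) summable_on (SIGMA n : UNIV. {..n})"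
      using F by (subst summable_on_reindex_bij_betw[OF bij])
    then show "?G summable_on (SIGMA n : UNIV. {..n})"
      by (subst summable_on_cong[OF G])
  qed
  then have "((\<lambda>p. ?F (case p of (n, m) \<Rightarrow> (n - m, m))) has_sum (1 / qpoch_inf q q)) (SIGMA n : UNIV. {..n})"
    by (subst has_sum_cong[OF G[symmetric]])
  then show ?thesis
    by (subst (asm) has_sum_reindex_bij_betw[OF bij])
qed

text \<open>
  Inserting the definition of \<open>qsum\<close> and putting \<open>a = k - s\<close>, \<open>b = s\<close> turns the left-hand side into an absolutely
  convergent sum over \<open>(j, a, b)\<close> in which \<open>\<alpha>\<close> only sees \<open>r = a - b\<close> and everything else is symmetric in
  \<open>a\<close> and \<open>b\<close>.  With \<open>m = min a b\<close>, the sum over \<open>(j, m)\<close> for fixed \<open>r\<close> is \<open>q\<^bsup>2r\<^sup>2\<^esup>\<close> times that of \<open>bailey_step\<close>.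
\<close>

theorem bailey_transform:
  fixes q :: complex and \<alpha> :: "int \<Rightarrow> complex"
  assumes q: "norm q < 1" "q \<noteq> 0"
  assumes bound: "\<And>r. norm (\<alpha> r) \<le> B"
  assumes A: "((\<lambda>r. \<alpha> r * q powi (2 * r\<^sup>2)) has_sum A) UNIV"
  shows "((\<lambda>(j, k). q ^ ((2 * j + k)\<^sup>2 + k\<^sup>2) * qsum (q ^ 4) \<alpha> k
              / (qpoch (q ^ 4) (q ^ 4) j * qpoch (q ^ 4) (q ^ 4) k))
            has_sum (A / qpoch_inf (q ^ 4) (q ^ 4))) UNIV"
proof -
  define Q where "Q = q ^ 4"
  have Q: "norm Q < 1" using q by (simp add: Q_def norm_power power_less_one_iff)
  note nz = qpoch_nonzero[OF Q Q]
  obtain K where K: "K > 0" "\<And>n. norm (1 / qpoch Q Q n) \<le> K"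
    using inverse_qpoch_bounded[OF Q Q] by blast
  have B: "B \<ge> 0" using norm_ge_zero bound by (rule order_trans)
  define F where "F = (\<lambda>(j, a, b). q ^ ((2 * j + (a + b))\<^sup>2 + (a + b)\<^sup>2) * \<alpha> (int a - int b)
                         / (qpoch Q Q j * qpoch Q Q a * qpoch Q Q b))"
  have geo: "(\<lambda>n. norm (norm q ^ n)) summable_on UNIV"
    using q by (simp add: summable_on_UNIV_nonneg_real_iff summable_geometric)
  have "(\<lambda>p. norm (F p)) summable_on UNIV"
  proof (rule summable_on_comparison_test)
    show "(\<lambda>p. norm (case p of (j, ab) \<Rightarrow> norm q ^ j * (case ab of (a, b) \<Rightarrow> norm q ^ a * norm q ^ b))
             * (B * (K * K * K))) summable_on UNIV"
      using summable_on_cmult_left[OF abs_summable_on_Times[OF geo abs_summable_on_Times[OF geo geo]]] by simp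
    fix p :: "nat \<times> nat \<times> nat"
    obtain j a b where p: "p = (j, a, b)" by (cases p) auto
    have "norm (F p) = norm q ^ ((2 * j + (a + b))\<^sup>2 + (a + b)\<^sup>2)
        * (norm (\<alpha> (int a - int b)) * (norm (1 / qpoch Q Q j) * norm (1 / qpoch Q Q a) * norm (1 / qpoch Q Q b)))"
      by (simp add: p F_def norm_mult norm_divide norm_power)
    also have "\<dots> \<le> norm q ^ (j + (a + b)) * (B * (K * K * K))"
      using q K B bound
      by (intro mult_mono power_decreasing square_plus_square_ge) (auto intro!: mult_nonneg_nonneg)
    finally show "norm (F p) \<le> norm (case p of (j, ab) \<Rightarrow> norm q ^ j * (case ab of (a, b) \<Rightarrow> norm q ^ a * norm q ^ b))
             * (B * (K * K * K))"
      by (simp add: p power_add mult_ac)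
  qed auto
  then have F: "F summable_on UNIV" by (rule abs_summable_summable)

  have F_sum: "(F has_sum (A * (1 / qpoch_inf Q Q))) UNIV"
  proof -
    have bij: "bij_betw (\<lambda>(r :: int, (j :: nat, m :: nat)). (j, m + nat r, m + nat (- r))) (UNIV \<times> UNIV) UNIV"
      by (rule bij_betw_byWitness[where f' = "\<lambda>(j, a, b). (int a - int b, (j, min a b))"]) auto
    have "((\<lambda>p. F (case p of (r, (j, m)) \<Rightarrow> (j, m + nat r, m + nat (- r)))) has_sum (A * (1 / qpoch_inf Q Q))) (UNIV \<times> UNIV)"
    proof (rule has_sum_SigmaI)
      fix r :: int
      define R where "R = nat \<bar>r\<bar>"
      have "F (j, m + nat r, m + nat (- r)) = \<alpha> r * q powi (2 * r\<^sup>2) *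
             (Q ^ ((j + m)\<^sup>2 + (j + m) * R) * Q ^ (m\<^sup>2 + m * R) / (qpoch Q Q j * qpoch Q Q m * qpoch Q Q (m + R)))" for j m
      proof -
        have r: "int (m + nat r) - int (m + nat (- r)) = r" "m + nat r + (m + nat (- r)) = 2 * m + R"
          by (auto simp: R_def)
        \<comment> \<open>One of the two indices is \<open>m\<close>, the other \<open>m + R\<close>, in an order that depends on the sign of \<open>r\<close>.\<close>
        have d: "qpoch Q Q (m + nat r) * qpoch Q Q (m + nat (- r)) = qpoch Q Q m * qpoch Q Q (m + R)"
          by (cases "r \<ge> 0") (auto simp: R_def)
        have "2 * r\<^sup>2 = int (2 * R\<^sup>2)" by (simp add: R_def)
        then have "q powi (2 * r\<^sup>2) = q ^ (2 * R\<^sup>2)" by (simp only: power_int_of_nat)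
        moreover have "(2 * j + (2 * m + R))\<^sup>2 + (2 * m + R)\<^sup>2
            = 2 * R\<^sup>2 + (4 * ((j + m)\<^sup>2 + (j + m) * R) + 4 * (m\<^sup>2 + m * R))"
          by (simp add: power2_eq_square algebra_simps)
        ultimately have e: "q ^ ((2 * j + (2 * m + R))\<^sup>2 + (2 * m + R)\<^sup>2)
            = q powi (2 * r\<^sup>2) * (Q ^ ((j + m)\<^sup>2 + (j + m) * R) * Q ^ (m\<^sup>2 + m * R))"
          by (simp only: Q_def flip: power_add power_mult)
        show ?thesis
          unfolding F_def split r e mult.assoc d by (simp add: mult_ac)
      qed
      then show "((\<lambda>y. F (case (r, y) of (r, (j, m)) \<Rightarrow> (j, m + nat r, m + nat (- r)))) has_sum
            \<alpha> r * q powi (2 * r\<^sup>2) * (1 / qpoch_inf Q Q)) UNIV"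
        using has_sum_cmult_right[OF bailey_step[OF Q, of R], of "\<alpha> r * q powi (2 * r\<^sup>2)"]
        by (simp add: case_prod_unfold)
    next
      show "((\<lambda>r. \<alpha> r * q powi (2 * r\<^sup>2) * (1 / qpoch_inf Q Q)) has_sum A * (1 / qpoch_inf Q Q)) UNIV"
        by (intro has_sum_cmult_left A)
      show "(\<lambda>p. F (case p of (r, (j, m)) \<Rightarrow> (j, m + nat r, m + nat (- r)))) summable_on UNIV \<times> UNIV"
        using F by (subst summable_on_reindex_bij_betw[OF bij])
    qed
    then show ?thesis
      by (subst (asm) has_sum_reindex_bij_betw[OF bij])
  qed

  have bij: "bij_betw (\<lambda>((j :: nat, k :: nat), s). (j, k - s, s)) (SIGMA (j, k) : UNIV. {..k}) UNIV"
    by (rule bij_betw_byWitness[where f' = "\<lambda>(j, a, b). ((j, a + b), b)"]) auto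
  have "((\<lambda>p. F ((\<lambda>((j, k), s). (j, k - s, s)) p)) has_sum (A * (1 / qpoch_inf Q Q))) (SIGMA (j, k) : UNIV. {..k})"
    using F_sum by (subst has_sum_reindex_bij_betw[OF bij])
  then have "((\<lambda>(j, k). q ^ ((2 * j + k)\<^sup>2 + k\<^sup>2) * qsum Q \<alpha> k / (qpoch Q Q j * qpoch Q Q k))
      has_sum (A * (1 / qpoch_inf Q Q))) UNIV"
  proof (rule has_sum_SigmaD)
    fix p :: "nat \<times> nat"
    obtain j k where p: "p = (j, k)" by force
    have "(\<Sum>s\<le>k. F (j, k - s, s)) = q ^ ((2 * j + k)\<^sup>2 + k\<^sup>2) * qsum Q \<alpha> k / (qpoch Q Q j * qpoch Q Q k)"
      unfolding qsum_def sum_distrib_left sum_divide_distrib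
    proof (rule sum.cong)
      fix s assume s: "s \<in> {..k}"
      then have "int (k - s) - int s = int k - 2 * int s" by auto
      then show "F (j, k - s, s) = q ^ ((2 * j + k)\<^sup>2 + k\<^sup>2) * (qbinom Q k s * \<alpha> (int k - 2 * int s))
                    / (qpoch Q Q j * qpoch Q Q k)"
        using s nz by (simp add: F_def qbinom_def)
    qed simp
    then show "((\<lambda>s. F ((\<lambda>((j, k), s). (j, k - s, s)) (p, s))) has_sum
        (case p of (j, k) \<Rightarrow> q ^ ((2 * j + k)\<^sup>2 + k\<^sup>2) * qsum Q \<alpha> k / (qpoch Q Q j * qpoch Q Q k)))
        (case p of (j, k) \<Rightarrow> {..k})"
      using has_sum_finite[of "{..k}" "\<lambda>s. F (j, k - s, s)"] by (simp add: p)
  qed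
  then show ?thesis by (simp add: Q_def)
qed

section \<open>Summation over the first index\<close>

lemma qpoch_mult_minus: "qpoch a q n * qpoch (- a) q n = qpoch (a\<^sup>2) (q\<^sup>2) n"
proof -
  have "(1 - a * q ^ m) * (1 - (- a) * q ^ m) = 1 - a\<^sup>2 * (q\<^sup>2) ^ m" for m
    by (simp add: algebra_simps power2_eq_square power_mult_distrib)
  then show ?thesis
    unfolding qpoch_def prod.distrib[symmetric] by simp
qed

lemma qpoch_inf_mult_minus:
  assumes "norm q < 1"
  shows "qpoch_inf a q * qpoch_inf (- a) q = qpoch_inf (a\<^sup>2) (q\<^sup>2)"
proof -
  have q2: "norm (q\<^sup>2) < 1" using assms by (simp add: norm_power abs_square_less_1)
  have "(\<lambda>n. qpoch a q n * qpoch (- a) q n) \<longlonglongrightarrow> qpoch_inf a q * qpoch_inf (- a) q"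
    by (intro tendsto_mult qpoch_LIMSEQ assms)
  moreover have "(\<lambda>n. qpoch a q n * qpoch (- a) q n) \<longlonglongrightarrow> qpoch_inf (a\<^sup>2) (q\<^sup>2)"
    unfolding qpoch_mult_minus by (rule qpoch_LIMSEQ[OF q2])
  ultimately show ?thesis by (rule LIMSEQ_unique)
qed

lemma euler_first_index:
  fixes q :: complex
  assumes q: "norm q < 1"
  shows "((\<lambda>i. q ^ (i\<^sup>2 + i + 2 * i * j) / (qpoch (q\<^sup>2) (q\<^sup>2) i * qpoch (q\<^sup>2) (q\<^sup>2) j))
          has_sum (qpoch_inf (- (q\<^sup>2)) (q\<^sup>2) / qpoch (q ^ 4) (q ^ 4) j)) UNIV"
proof -
  have q2: "norm (q\<^sup>2) < 1" using q by (simp add: norm_power abs_square_less_1)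
  have q4: "norm (q ^ 4) < 1" using q by (simp add: norm_power power_less_one_iff)
  have sq: "(q\<^sup>2)\<^sup>2 = q ^ 4" by simp
  have "- (q\<^sup>2) * (q\<^sup>2) ^ j = - q * q ^ (1 + 2 * j)"
    by (simp add: power2_eq_square power_add power_mult mult_ac power_mult_distrib)
  then have split: "qpoch_inf (- (q\<^sup>2)) (q\<^sup>2) = qpoch (- (q\<^sup>2)) (q\<^sup>2) j * qpoch_inf (- q * q ^ (1 + 2 * j)) (q\<^sup>2)"
    using qpoch_inf_split[OF q2, of "- (q\<^sup>2)" j] by simp
  have nz: "qpoch (q\<^sup>2) (q\<^sup>2) j \<noteq> 0" "qpoch (q ^ 4) (q ^ 4) j \<noteq> 0"
    by (intro qpoch_nonzero q2 q4)+
  have fin: "qpoch (q\<^sup>2) (q\<^sup>2) j * qpoch (- (q\<^sup>2)) (q\<^sup>2) j = qpoch (q ^ 4) (q ^ 4) j"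
    unfolding qpoch_mult_minus sq ..
  have val: "qpoch_inf (- (q\<^sup>2)) (q\<^sup>2) / qpoch (q ^ 4) (q ^ 4) j
      = qpoch_inf (- q * q ^ (1 + 2 * j)) (q\<^sup>2) * (1 / qpoch (q\<^sup>2) (q\<^sup>2) j)"
    using nz unfolding split fin[symmetric] by (simp add: field_simps)
  have "q ^ (i\<^sup>2 + i + 2 * i * j) / (qpoch (q\<^sup>2) (q\<^sup>2) i * qpoch (q\<^sup>2) (q\<^sup>2) j)
      = q ^ i\<^sup>2 * (q ^ (1 + 2 * j)) ^ i / qpoch (q\<^sup>2) (q\<^sup>2) i * (1 / qpoch (q\<^sup>2) (q\<^sup>2) j)" for i
  proof -
    have "i\<^sup>2 + i + 2 * i * j = i\<^sup>2 + (1 + 2 * j) * i" by (simp add: algebra_simps)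
    then have "q ^ (i\<^sup>2 + i + 2 * i * j) = q ^ i\<^sup>2 * (q ^ (1 + 2 * j)) ^ i"
      by (simp only: power_add power_mult)
    then show ?thesis by (simp only:) simp
  qed
  then show ?thesis
    unfolding val by (simp only:) (intro has_sum_cmult_left euler_has_sum q)
qed

text \<open>
  The lower bound on the exponent gives a geometric majorant in all three indices, so the sum over \<open>i\<close> may be
  carried out first.
\<close>

lemma triple_sum_reduction:
  fixes q S :: complex and e :: "nat \<Rightarrow> nat \<Rightarrow> int"
  assumes q: "norm q < 1" "q \<noteq> 0"
  assumes e: "\<And>j k. int (j + k) \<le> e j k"
  assumes S: "((\<lambda>(j, k). q powi e j k / (qpoch (q ^ 4) (q ^ 4) j * qpoch (q ^ 4) (q ^ 4) k)) has_sum S) UNIV"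
  shows "((\<lambda>(i, j, k). q powi (int (i\<^sup>2 + i + 2 * i * j) + e j k)
            / (qpoch (q^2) (q^2) i * qpoch (q^2) (q^2) j * qpoch (q^4) (q^4) k))
          has_sum (qpoch_inf (- (q\<^sup>2)) (q\<^sup>2) * S)) UNIV"
    (is "(?F has_sum _) UNIV")
proof -
  have q2: "norm (q\<^sup>2) < 1" using q by (simp add: norm_power abs_square_less_1)
  have q4: "norm (q ^ 4) < 1" using q by (simp add: norm_power power_less_one_iff)
  obtain K where K: "K > 0" "\<And>n. norm (1 / qpoch (q\<^sup>2) (q\<^sup>2) n) \<le> K"
    using inverse_qpoch_bounded[OF q2 q2] by blast
  obtain L where L: "L > 0" "\<And>n. norm (1 / qpoch (q ^ 4) (q ^ 4) n) \<le> L"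
    using inverse_qpoch_bounded[OF q4 q4] by blast
  have geo: "(\<lambda>n. norm (norm q ^ n)) summable_on UNIV"
    using q by (simp add: summable_on_UNIV_nonneg_real_iff summable_geometric)
  have "(\<lambda>p. norm (?F p)) summable_on UNIV"
  proof (rule summable_on_comparison_test)
    show "(\<lambda>p. norm (case p of (i, jk) \<Rightarrow> norm q ^ i * (case jk of (j, k) \<Rightarrow> norm q ^ j * norm q ^ k))
             * (K * K * L)) summable_on UNIV"
      using summable_on_cmult_left[OF abs_summable_on_Times[OF geo abs_summable_on_Times[OF geo geo]]] by simp
    fix p :: "nat \<times> nat \<times> nat"
    obtain i j k where p: "p = (i, j, k)" by (cases p) auto
    have "norm (?F p) = norm q powi (int (i\<^sup>2 + i + 2 * i * j) + e j k)
        * (norm (1 / qpoch (q\<^sup>2) (q\<^sup>2) i) * norm (1 / qpoch (q\<^sup>2) (q\<^sup>2) j) * norm (1 / qpoch (q ^ 4) (q ^ 4) k))"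
      by (simp add: p norm_mult norm_divide norm_power_int)
    also have "\<dots> \<le> norm q ^ (i + (j + k)) * (K * K * L)"
    proof -
      have "int (i + (j + k)) \<le> int (i\<^sup>2 + i + 2 * i * j) + e j k"
      proof -
        have "i + (j + k) \<le> i\<^sup>2 + i + 2 * i * j + (j + k)" by simp
        then have "int (i + (j + k)) \<le> int (i\<^sup>2 + i + 2 * i * j) + int (j + k)"
          by (simp only: of_nat_add[symmetric] of_nat_le_iff)
        then show ?thesis using e[of j k] by linarith
      qed
      then have "norm q powi (int (i\<^sup>2 + i + 2 * i * j) + e j k) \<le> norm q powi int (i + (j + k))"
        using q by (intro power_int_decreasing) auto
      then show ?thesis
        unfolding power_int_of_nat using q K L by (intro mult_mono) (auto intro!: mult_nonneg_nonneg)
    qed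
    finally show "norm (?F p) \<le> norm (case p of (i, jk) \<Rightarrow> norm q ^ i * (case jk of (j, k) \<Rightarrow> norm q ^ j * norm q ^ k))
             * (K * K * L)"
      by (simp add: p power_add mult_ac)
  qed auto
  then have F: "?F summable_on UNIV" by (rule abs_summable_summable)
  have bij: "bij_betw (\<lambda>(jk :: nat \<times> nat, i :: nat). (i, jk)) (UNIV \<times> UNIV) UNIV"
    by (rule bij_betw_byWitness[where f' = "\<lambda>(i, jk). (jk, i)"]) auto
  have "((\<lambda>p. ?F (case p of (jk, i) \<Rightarrow> (i, jk))) has_sum (qpoch_inf (- (q\<^sup>2)) (q\<^sup>2) * S)) (UNIV \<times> UNIV)"
  proof (rule has_sum_SigmaI)
    show "((\<lambda>p. qpoch_inf (- (q\<^sup>2)) (q\<^sup>2) * (case p of (j, k) \<Rightarrow>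
            q powi e j k / (qpoch (q ^ 4) (q ^ 4) j * qpoch (q ^ 4) (q ^ 4) k)))
          has_sum (qpoch_inf (- (q\<^sup>2)) (q\<^sup>2) * S)) UNIV"
      by (intro has_sum_cmult_right S)
    show "(\<lambda>p. ?F (case p of (jk, i) \<Rightarrow> (i, jk))) summable_on UNIV \<times> UNIV"
      using F by (subst summable_on_reindex_bij_betw[OF bij])
    fix p :: "nat \<times> nat"
    obtain j k where p: "p = (j, k)" by force
    have "q powi (int (i\<^sup>2 + i + 2 * i * j) + e j k) = q ^ (i\<^sup>2 + i + 2 * i * j) * q powi e j k" for i
      using q by (simp only: power_int_add power_int_of_nat simp_thms)
    then show "((\<lambda>i. ?F (case (p, i) of (jk, i) \<Rightarrow> (i, jk))) has_sum
        qpoch_inf (- (q\<^sup>2)) (q\<^sup>2) * (case p of (j, k) \<Rightarrow>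
            q powi e j k / (qpoch (q ^ 4) (q ^ 4) j * qpoch (q ^ 4) (q ^ 4) k))) UNIV"
      using has_sum_cmult_right[OF euler_first_index[OF q(1), of j], of "q powi e j k / qpoch (q ^ 4) (q ^ 4) k"]
      by (simp add: p mult_ac)
  qed
  then show ?thesis
    by (subst (asm) has_sum_reindex_bij_betw[OF bij])
qed

section \<open>The theta series modulo 28\<close>

text \<open>
  The quintuple product with base \<open>q\<^bsup>14\<^esup>\<close> and variable \<open>-q\<^sup>a\<close>; for \<open>a = 1, 3, 5\<close> it belongs to the three identities.
\<close>

definition theta28 :: "complex \<Rightarrow> nat \<Rightarrow> complex" where
  "theta28 q a = qpoch_inf (- (q ^ a)) (q ^ 14) * qpoch_inf (- (q ^ (14 - a))) (q ^ 14) * qpoch_inf (q ^ 14) (q ^ 14)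
     * qpoch_inf (q ^ (14 - 2 * a)) (q ^ 28) * qpoch_inf (q ^ (14 + 2 * a)) (q ^ 28)"

text \<open>
  The quintuple product with \<open>y = g\<^sup>7\<close> and \<open>w = g\<^bsup>7-3a\<^esup>\<close>, so that \<open>y / w = q\<^sup>a\<close> and \<open>y\<^sup>6 = q\<^bsup>14\<^esup>\<close> for \<open>q = g\<^sup>3\<close>.
\<close>

lemma theta28_has_sum:
  fixes g :: complex
  assumes g: "norm g < 1" "g \<noteq> 0" and a: "a \<le> 7"
  shows "((\<lambda>r. \<epsilon> r * g powi (7 * r\<^sup>2 + (7 - 3 * int a) * r)) has_sum theta28 (g ^ 3) a) UNIV"
proof -
  have g7: "norm (g ^ 7) < 1" "g ^ 7 \<noteq> 0" using g by (simp_all add: norm_power power_less_one_iff)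
  define w where "w = g powi (7 - 3 * int a)"
  have w: "w \<noteq> 0" using g by (simp add: w_def)
  have "g ^ 7 / w = (g ^ 3) ^ a"
  proof -
    have "g ^ 7 / w = g powi (int 7 - (7 - 3 * int a))"
      using g unfolding w_def by (subst power_int_diff) auto
    also have "int 7 - (7 - 3 * int a) = int (3 * a)" by simp
    finally show ?thesis unfolding power_int_of_nat power_mult .
  qed
  moreover have "(g ^ 7) ^ 5 * w = (g ^ 3) ^ (14 - a)"
  proof -
    have "(g ^ 7) ^ 5 * w = g powi (int 35 + (7 - 3 * int a))"
      using g unfolding w_def by (subst power_int_add) (auto simp flip: power_mult)
    also have "int 35 + (7 - 3 * int a) = int (3 * (14 - a))" using a by simp
    finally show ?thesis unfolding power_int_of_nat power_mult .
  qed
  moreover have "(g ^ 7) ^ 4 * w\<^sup>2 = (g ^ 3) ^ (14 - 2 * a)"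
  proof -
    have "w\<^sup>2 = g powi ((7 - 3 * int a) * 2)" unfolding w_def by (subst power_int_mult) simp
    then have "(g ^ 7) ^ 4 * w\<^sup>2 = g powi (int 28 + (7 - 3 * int a) * 2)"
      using g by (subst power_int_add) (auto simp flip: power_mult)
    also have "int 28 + (7 - 3 * int a) * 2 = int (3 * (14 - 2 * a))" using a by simp
    finally show ?thesis unfolding power_int_of_nat power_mult .
  qed
  moreover have "(g ^ 7) ^ 8 / w\<^sup>2 = (g ^ 3) ^ (14 + 2 * a)"
  proof -
    have "w\<^sup>2 = g powi ((7 - 3 * int a) * 2)" unfolding w_def by (subst power_int_mult) simp
    then have "(g ^ 7) ^ 8 / w\<^sup>2 = g powi (int 56 - (7 - 3 * int a) * 2)"
      using g by (subst power_int_diff) (auto simp flip: power_mult)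
    also have "int 56 - (7 - 3 * int a) * 2 = int (3 * (14 + 2 * a))" by simp
    finally show ?thesis unfolding power_int_of_nat power_mult .
  qed
  moreover have "(g ^ 7) ^ 6 = (g ^ 3) ^ 14" "(g ^ 7) ^ 12 = (g ^ 3) ^ 28"
    by (simp_all flip: power_mult)
  moreover have "\<epsilon> r * (g ^ 7) powi r\<^sup>2 * w powi r = \<epsilon> r * g powi (7 * r\<^sup>2 + (7 - 3 * int a) * r)" for r
    unfolding w_def using g by (simp add: power_int_add power_int_mult)
  ultimately show ?thesis
    using quintuple_product[OF g7 w] unfolding theta28_def by (simp only: minus_divide_left[symmetric] mult_minus_left)
qed

lemma norm_eps_powi_le:
  fixes g :: complex
  assumes "norm g < 1" "g \<noteq> 0" "- d \<le> e"
  shows "norm (\<epsilon> r * g powi e) \<le> norm g powi (- d)"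
proof -
  have "norm (\<epsilon> r * g powi e) \<le> 1 * norm g powi (- d)"
    unfolding norm_mult norm_power_int using assms
    by (intro mult_mono power_int_decreasing) (auto simp: \<epsilon>_def)
  then show ?thesis by simp
qed

text \<open>
  The Bailey transform adds \<open>2 r\<^sup>2\<close> to the exponent of \<open>q\<close>, that is \<open>6 r\<^sup>2\<close> to that of \<open>g\<close>; the translation by \<open>t\<close> brings the
  argument of \<open>\<epsilon>\<close> back to \<open>r\<close> and is needed for \<open>qsum_upper\<close>.
\<close>

lemma double_sum_theta28:
  fixes g :: complex and f :: "nat \<Rightarrow> complex"
  assumes g: "norm g < 1" "g \<noteq> 0" and a: "a \<le> 7"
  assumes f: "\<And>k. qsum ((g ^ 6)\<^sup>2) (\<lambda>r. \<epsilon> (r + t) * g powi (r\<^sup>2 + c * r + d)) k = f k"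
  assumes shift: "\<And>r. (r - t)\<^sup>2 + c * (r - t) + d + 6 * (r - t)\<^sup>2 = 7 * r\<^sup>2 + (7 - 3 * int a) * r"
  shows "((\<lambda>(j, k). (g ^ 3) ^ ((2 * j + k)\<^sup>2 + k\<^sup>2) * f k
              / (qpoch ((g ^ 3) ^ 4) ((g ^ 3) ^ 4) j * qpoch ((g ^ 3) ^ 4) ((g ^ 3) ^ 4) k))
            has_sum (theta28 (g ^ 3) a / qpoch_inf ((g ^ 3) ^ 4) ((g ^ 3) ^ 4))) UNIV"
proof -
  let ?\<alpha> = "\<lambda>r. \<epsilon> (r + t) * g powi (r\<^sup>2 + c * r + d)"
  have q: "norm (g ^ 3) < 1" "g ^ 3 \<noteq> 0" using g by (simp_all add: norm_power power_less_one_iff)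
  have bound: "norm (?\<alpha> r) \<le> norm g powi (- (c\<^sup>2 - d))" for r
  proof (rule norm_eps_powi_le[OF g])
    \<comment> \<open>\<open>r\<^sup>2 + c r \<ge> - c\<^sup>2 / 4\<close>, so the weights are bounded.\<close>
    have "0 \<le> (2 * r + c)\<^sup>2" by simp
    then have "0 \<le> 4 * r\<^sup>2 + 4 * (c * r) + c\<^sup>2" by (simp add: power2_eq_square algebra_simps)
    moreover have "0 \<le> c\<^sup>2" by simp
    ultimately show "- (c\<^sup>2 - d) \<le> r\<^sup>2 + c * r + d" by linarith
  qed
  have bij: "bij_betw (\<lambda>r :: int. r - t) UNIV UNIV"
    by (rule bij_betw_byWitness[where f' = "\<lambda>r. r + t"]) auto
  have "((\<lambda>r. ?\<alpha> r * (g ^ 3) powi (2 * r\<^sup>2)) has_sum theta28 (g ^ 3) a) UNIV"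
  proof -
    have "?\<alpha> (r - t) * (g ^ 3) powi (2 * (r - t)\<^sup>2) = \<epsilon> r * g powi (7 * r\<^sup>2 + (7 - 3 * int a) * r)" for r
    proof -
      have "(g ^ 3) powi (2 * (r - t)\<^sup>2) = g powi (3 * (2 * (r - t)\<^sup>2))"
        by (simp only: power_int_mult power_int_numeral)
      then have "?\<alpha> (r - t) * (g ^ 3) powi (2 * (r - t)\<^sup>2)
          = \<epsilon> r * (g powi ((r - t)\<^sup>2 + c * (r - t) + d) * g powi (6 * (r - t)\<^sup>2))"
        by simp
      also have "g powi ((r - t)\<^sup>2 + c * (r - t) + d) * g powi (6 * (r - t)\<^sup>2)
          = g powi (7 * r\<^sup>2 + (7 - 3 * int a) * r)"
        unfolding shift[symmetric] using g by (intro power_int_add[symmetric]) auto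
      finally show ?thesis .
    qed
    then have "((\<lambda>r. ?\<alpha> (r - t) * (g ^ 3) powi (2 * (r - t)\<^sup>2)) has_sum theta28 (g ^ 3) a) UNIV"
      using theta28_has_sum[OF g a] by (simp only:)
    then show ?thesis
      using has_sum_reindex_bij_betw[OF bij, of "\<lambda>r. ?\<alpha> r * (g ^ 3) powi (2 * r\<^sup>2)"] by simp
  qed
  moreover have "(g ^ 3) ^ 4 = (g ^ 6)\<^sup>2" by (simp flip: power_mult)
  ultimately show ?thesis
    using bailey_transform[where \<alpha> = ?\<alpha> and A = "theta28 (g ^ 3) a", OF q bound] by (simp only: f)
qed

text \<open>
  Everything is expressed by the products \<open>p n = (q\<^sup>n;q\<^bsup>28\<^esup>)\<^sub>\<infinity>\<close>.  The factors with negative argument are removed by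
  \<open>(-a;q)\<^sub>\<infinity> = (a\<^sup>2;q\<^sup>2)\<^sub>\<infinity> / (a;q)\<^sub>\<infinity>\<close>; in the quotient by \<open>J\<^sub>4 = p 4 p 8 p 12 p 16 p 20 p 24 p 28\<close>, the
  factors \<open>p (14 - 2a) p (14 + 2a)\<close> of \<open>theta28\<close> cancel one of the pairs \<open>p 4 p 24\<close>, \<open>p 8 p 20\<close>, \<open>p 12 p 16\<close>.
  The other two pairs are the factors of the denominator whose index is divisible by \<open>4\<close>.
\<close>

lemma theta28_product:
  fixes q :: complex
  assumes q: "norm q < 1" "q \<noteq> 0"
  shows "qpoch_inf (- (q\<^sup>2)) (q\<^sup>2) * (theta28 q 1 / qpoch_inf (q ^ 4) (q ^ 4))
           = J1 q 4 * J1 q 14 * (J1 q 28)^2 * J2 q 2 28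
             / (J1 q 2 * J2 q 1 28 * J2 q 4 28 * J2 q 8 28 * J2 q 13 28)"
    and "qpoch_inf (- (q\<^sup>2)) (q\<^sup>2) * (theta28 q 3 / qpoch_inf (q ^ 4) (q ^ 4))
           = J1 q 4 * J1 q 14 * (J1 q 28)^2 * J2 q 6 28
             / (J1 q 2 * J2 q 3 28 * J2 q 4 28 * J2 q 11 28 * J2 q 12 28)"
    and "qpoch_inf (- (q\<^sup>2)) (q\<^sup>2) * (theta28 q 5 / qpoch_inf (q ^ 4) (q ^ 4))
           = J1 q 4 * J1 q 14 * (J1 q 28)^2 * J2 q 10 28
             / (J1 q 2 * J2 q 5 28 * J2 q 8 28 * J2 q 9 28 * J2 q 12 28)"
proof -
  define p where "p n = qpoch_inf (q ^ n) (q ^ 28)" for n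
  have qn: "norm (q ^ n) < 1" if "n > 0" for n
    using q that by (simp add: norm_power power_less_one_iff)
  have p_nz: "p n \<noteq> 0" if "n > 0" for n
    unfolding p_def using that by (intro qpoch_inf_nonzero qn) auto
  have J_nz: "J1 q n \<noteq> 0" if "n > 0" for n
    unfolding J1_def using that by (intro qpoch_inf_nonzero qn) auto
  have J28: "J1 q 28 = p 28" by (simp add: J1_def p_def)
  have J4: "J1 q 4 = p 4 * p 8 * p 12 * p 16 * p 20 * p 24 * p 28"
    using qpoch_inf_multisection[OF qn[of 4], of 7 "q ^ 4"]
    by (simp add: J1_def p_def lessThan_nat_numeral mult_ac flip: power_mult power_add)
  have J2: "J2 q n 28 = p n * p (28 - n) * p 28" if "n \<le> 28" for n
  proof -
    have "int 28 - int n = int (28 - n)" using that by simp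
    then show ?thesis by (simp only: J2_def p_def power_int_of_nat)
  qed
  have minus_q2: "qpoch_inf (- (q\<^sup>2)) (q\<^sup>2) = J1 q 4 / J1 q 2"
    using qpoch_inf_mult_minus[OF qn[of 2], of "q\<^sup>2"] J_nz[of 2] by (simp add: J1_def field_simps)
  have minus: "qpoch_inf (- (q ^ n)) (q ^ 14) = p (2 * n) / (p n * p (n + 14))" if "n > 0" for n
  proof -
    have "qpoch_inf (q ^ n) (q ^ 14) = p n * p (n + 14)"
      using qpoch_inf_multisection[OF qn[of 14], of 2 "q ^ n"]
      by (simp add: p_def lessThan_nat_numeral mult_ac flip: power_mult power_add)
    moreover have "qpoch_inf (q ^ n) (q ^ 14) * qpoch_inf (- (q ^ n)) (q ^ 14) = p (2 * n)"
      using qpoch_inf_mult_minus[OF qn[of 14], of "q ^ n"] by (simp add: p_def mult.commute flip: power_mult)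
    ultimately show ?thesis
      using p_nz[of n] p_nz[of "n + 14"] that by (simp add: field_simps)
  qed
  have theta: "theta28 q a = p (2 * a) * p (28 - 2 * a) * J1 q 14 * p (14 - 2 * a) * p (14 + 2 * a)
                 / (p a * p (a + 14) * p (14 - a) * p (28 - a))" if "a > 0" "a < 7" for a
  proof -
    have "2 * (14 - a) = 28 - 2 * a" "14 - a + 14 = 28 - a" using that by auto
    then show ?thesis
      using minus[of a] minus[of "14 - a"] that by (simp add: theta28_def J1_def p_def)
  qed
  show "qpoch_inf (- (q\<^sup>2)) (q\<^sup>2) * (theta28 q 1 / qpoch_inf (q ^ 4) (q ^ 4))
           = J1 q 4 * J1 q 14 * (J1 q 28)^2 * J2 q 2 28
             / (J1 q 2 * J2 q 1 28 * J2 q 4 28 * J2 q 8 28 * J2 q 13 28)"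
    unfolding minus_q2 J1_def[of q 4, symmetric] using p_nz J_nz[of 2]
    by (simp add: theta J2 J28) (simp add: J4 divide_simps power2_eq_square)
  show "qpoch_inf (- (q\<^sup>2)) (q\<^sup>2) * (theta28 q 3 / qpoch_inf (q ^ 4) (q ^ 4))
           = J1 q 4 * J1 q 14 * (J1 q 28)^2 * J2 q 6 28
             / (J1 q 2 * J2 q 3 28 * J2 q 4 28 * J2 q 11 28 * J2 q 12 28)"
    unfolding minus_q2 J1_def[of q 4, symmetric] using p_nz J_nz[of 2]
    by (simp add: theta J2 J28) (simp add: J4 divide_simps power2_eq_square)
  show "qpoch_inf (- (q\<^sup>2)) (q\<^sup>2) * (theta28 q 5 / qpoch_inf (q ^ 4) (q ^ 4))
           = J1 q 4 * J1 q 14 * (J1 q 28)^2 * J2 q 10 28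
             / (J1 q 2 * J2 q 5 28 * J2 q 8 28 * J2 q 9 28 * J2 q 12 28)"
    unfolding minus_q2 J1_def[of q 4, symmetric] using p_nz J_nz[of 2]
    by (simp add: theta J2 J28) (simp add: J4 divide_simps power2_eq_square)
qed


section \<open>The three identities\<close>

theorem theorem3p6:
  fixes q :: complex
  assumes "0 < norm q" and "norm q < 1"
  shows
    "((\<lambda>(i :: nat, j :: nat, k :: nat).
        q powi ((int i)^2 + 4 * (int j)^2 + 3 * (int k)^2 + 2 * int i * int j + 4 * int j * int k
                + int i - 2 * int k)
        / (qpoch (q^2) (q^2) i * qpoch (q^2) (q^2) j * qpoch (q^4) (q^4) k))
      has_sum
        (J1 q 4 * J1 q 14 * (J1 q 28)^2 * J2 q 2 28
         / (J1 q 2 * J2 q 1 28 * J2 q 4 28 * J2 q 8 28 * J2 q 13 28))) UNIV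
     \<and>
     ((\<lambda>(i :: nat, j :: nat, k :: nat).
        q powi ((int i)^2 + 4 * (int j)^2 + 3 * (int k)^2 + 2 * int i * int j + 4 * int j * int k
                + int i)
        / (qpoch (q^2) (q^2) i * qpoch (q^2) (q^2) j * qpoch (q^4) (q^4) k))
      has_sum
        (J1 q 4 * J1 q 14 * (J1 q 28)^2 * J2 q 6 28
         / (J1 q 2 * J2 q 3 28 * J2 q 4 28 * J2 q 11 28 * J2 q 12 28))) UNIV
     \<and>
     ((\<lambda>(i :: nat, j :: nat, k :: nat).
        q powi ((int i)^2 + 4 * (int j)^2 + 3 * (int k)^2 + 2 * int i * int j + 4 * int j * int k
                + int i + 4 * int j + 2 * int k)
        / (qpoch (q^2) (q^2) i * qpoch (q^2) (q^2) j * qpoch (q^4) (q^4) k))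
      has_sum
        (J1 q 4 * J1 q 14 * (J1 q 28)^2 * J2 q 10 28
         / (J1 q 2 * J2 q 5 28 * J2 q 8 28 * J2 q 9 28 * J2 q 12 28))) UNIV"
proof -
  obtain g where g3: "g ^ 3 = q"
    using exists_complex_root[of 3 q] by auto
  have q: "norm q < 1" "q \<noteq> 0" using assms by auto
  have "norm g ^ 3 < 1" using q by (simp add: norm_power flip: g3)
  then have g: "norm g < 1" "g \<noteq> 0"
    using q by (auto simp: power_less_one_iff g3[symmetric])
  let ?D = "\<lambda>j k. qpoch (q ^ 4) (q ^ 4) j * qpoch (q ^ 4) (q ^ 4) k"
  have q4: "norm (q ^ 4) < 1" using q by (simp add: norm_power power_less_one_iff)
  have g_powi: "g powi (3 * e) = q powi e" for e
    by (simp only: g3[symmetric] power_int_mult power_int_numeral)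
  have combine: "q ^ m * q powi e = q powi (int m + e)" for m e
    using q by (simp add: power_int_add)

  have 1: "((\<lambda>(j, k). q powi (4 * (int j)\<^sup>2 + 3 * (int k)\<^sup>2 + 4 * int j * int k - 2 * int k) / ?D j k)
              has_sum (theta28 q 1 / qpoch_inf (q ^ 4) (q ^ 4))) UNIV"
  proof -
    have "qsum ((g ^ 6)\<^sup>2) (\<lambda>r. \<epsilon> (r + 0) * g powi (r\<^sup>2 + 4 * r + 0)) k = q powi ((int k)\<^sup>2 - 2 * int k)" for k
      using qsum_lower[OF g(2,1), of k] g_powi[of "(int k)\<^sup>2 - 2 * int k"] by (simp add: algebra_simps)
    note * = double_sum_theta28[OF g _ this, of 1, unfolded g3]
    have "((\<lambda>(j, k). q ^ ((2 * j + k)\<^sup>2 + k\<^sup>2) * q powi ((int k)\<^sup>2 - 2 * int k) / ?D j k)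
            has_sum (theta28 q 1 / qpoch_inf (q ^ 4) (q ^ 4))) UNIV"
      by (rule *) (simp_all add: power2_eq_square algebra_simps)
    then show ?thesis
      unfolding combine by (simp add: power2_eq_square algebra_simps)
  qed
  have 2: "((\<lambda>(j, k). q powi (4 * (int j)\<^sup>2 + 3 * (int k)\<^sup>2 + 4 * int j * int k) / ?D j k)
              has_sum (theta28 q 3 / qpoch_inf (q ^ 4) (q ^ 4))) UNIV"
  proof -
    have "qsum ((g ^ 6)\<^sup>2) (\<lambda>r. \<epsilon> (r + 0) * g powi (r\<^sup>2 + (- 2) * r + 0)) k = q powi ((int k)\<^sup>2)" for k
      using qsum_middle[OF g(2,1), of k] by (simp flip: g3 power_mult of_nat_power)
    note * = double_sum_theta28[OF g _ this, of 3, unfolded g3]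
    have "((\<lambda>(j, k). q ^ ((2 * j + k)\<^sup>2 + k\<^sup>2) * q powi ((int k)\<^sup>2) / ?D j k)
            has_sum (theta28 q 3 / qpoch_inf (q ^ 4) (q ^ 4))) UNIV"
      by (rule *) (simp_all add: power2_eq_square algebra_simps)
    then show ?thesis
      unfolding combine by (simp add: power2_eq_square algebra_simps)
  qed
  have 3: "((\<lambda>(j, k). q powi (4 * (int j)\<^sup>2 + 3 * (int k)\<^sup>2 + 4 * int j * int k + 4 * int j + 2 * int k) / ?D j k)
              has_sum (theta28 q 5 / qpoch_inf (q ^ 4) (q ^ 4))) UNIV"
  proof -
    \<comment> \<open>When \<open>k\<close> is counted from \<open>1\<close>, the third exponent is \<open>(2j+k)\<^sup>2 + 2k\<^sup>2 - 4k + 1\<close>; the factor \<open>1 - q\<^bsup>4k\<^esup>\<close> of \<open>f\<close> turns \<open>(Q;Q)\<^sub>k\<close> into \<open>(Q;Q)\<^bsub>k-1\<^esub>\<close> and kills the term \<open>k = 0\<close>.\<close>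
    define f where "f k = q powi ((int k)\<^sup>2 - 4 * int k + 1) - q powi ((int k)\<^sup>2 + 1)" for k :: nat
    have "qsum ((g ^ 6)\<^sup>2) (\<lambda>r. \<epsilon> (r + 1) * g powi (r\<^sup>2 + 6 * r + (- 1))) k = f k" for k
      using qsum_upper[OF g(2,1), of k] g_powi[of "(int k)\<^sup>2 - 4 * int k + 1"] g_powi[of "(int k)\<^sup>2 + 1"]
      by (simp add: f_def algebra_simps)
    note * = double_sum_theta28[OF g _ this, of 5, unfolded g3]
    let ?G = "\<lambda>(j, k). q ^ ((2 * j + k)\<^sup>2 + k\<^sup>2) * f k / ?D j k"
    have "(?G has_sum (theta28 q 5 / qpoch_inf (q ^ 4) (q ^ 4))) UNIV"
      by (rule *) (simp_all add: power2_eq_square algebra_simps)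
    moreover have "?G p = 0" if "p \<notin> range (\<lambda>(j, k). (j, Suc k))" for p
    proof (cases p)
      case (Pair j k)
      with that have "k = 0" by (cases k) (auto simp: image_iff)
      then show ?thesis by (simp add: Pair f_def)
    qed
    ultimately have "(?G has_sum (theta28 q 5 / qpoch_inf (q ^ 4) (q ^ 4))) (range (\<lambda>(j, k). (j, Suc k)))"
      by (subst has_sum_cong_neutral[of UNIV]) auto
    moreover have "bij_betw (\<lambda>(j :: nat, k). (j, Suc k)) UNIV (range (\<lambda>(j, k). (j, Suc k)))"
      by (rule inj_on_imp_bij_betw) (auto simp: inj_on_def)
    ultimately have G_sum: "((\<lambda>p. ?G ((\<lambda>(j, k). (j, Suc k)) p)) has_sum (theta28 q 5 / qpoch_inf (q ^ 4) (q ^ 4))) UNIV"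
      by (subst has_sum_reindex_bij_betw)
    have G_Suc: "?G ((\<lambda>(j, k). (j, Suc k)) (j, k))
        = q powi (4 * (int j)\<^sup>2 + 3 * (int k)\<^sup>2 + 4 * int j * int k + 4 * int j + 2 * int k) / ?D j k" for j k
    proof -
      define e where "e = (int (Suc k))\<^sup>2 - 4 * int (Suc k) + 1"
      have "(int (Suc k))\<^sup>2 + 1 = e + int (4 * Suc k)" by (simp add: e_def)
      then have "q powi ((int (Suc k))\<^sup>2 + 1) = q powi e * (q ^ 4) ^ Suc k"
        using q by (simp only: power_int_add power_int_of_nat power_mult simp_thms)
      then have f: "f (Suc k) = q powi e * (1 - q ^ 4 * (q ^ 4) ^ k)"
        by (simp add: f_def e_def algebra_simps)
      have nz: "1 - q ^ 4 * (q ^ 4) ^ k \<noteq> 0"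
        by (rule one_minus_mult_power_nonzero[OF q4 q4])
      have "int ((2 * j + Suc k)\<^sup>2 + (Suc k)\<^sup>2) + e
          = 4 * (int j)\<^sup>2 + 3 * (int k)\<^sup>2 + 4 * int j * int k + 4 * int j + 2 * int k"
        by (simp add: e_def power2_eq_square algebra_simps)
      then have "q ^ ((2 * j + Suc k)\<^sup>2 + (Suc k)\<^sup>2) * q powi e
          = q powi (4 * (int j)\<^sup>2 + 3 * (int k)\<^sup>2 + 4 * int j * int k + 4 * int j + 2 * int k)"
        by (simp only: combine)
      then show ?thesis
        unfolding split f qpoch_Suc mult.assoc[symmetric] using nz by simp
    qed
    show ?thesis
    proof (subst has_sum_cong)
      fix p :: "nat \<times> nat"
      obtain j k where p: "p = (j, k)" by force
      show "(case p of (j, k) \<Rightarrow> q powi (4 * (int j)\<^sup>2 + 3 * (int k)\<^sup>2 + 4 * int j * int k + 4 * int j + 2 * int k) / ?D j k)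
          = ?G ((\<lambda>(j, k). (j, Suc k)) p)"
        unfolding p G_Suc by simp
    qed (rule G_sum)
  qed

  have le: "int k \<le> (int k)\<^sup>2" "0 \<le> int j * int k" for j k
    by (simp_all add: power2_eq_square flip: of_nat_mult)
  have e: "int (j + k) \<le> 4 * (int j)\<^sup>2 + 3 * (int k)\<^sup>2 + 4 * int j * int k - 2 * int k"
      "int (j + k) \<le> 4 * (int j)\<^sup>2 + 3 * (int k)\<^sup>2 + 4 * int j * int k"
      "int (j + k) \<le> 4 * (int j)\<^sup>2 + 3 * (int k)\<^sup>2 + 4 * int j * int k + 4 * int j + 2 * int k" for j k
    using le(1)[of j] le(1)[of k] le(2)[of j k] by (simp_all only: mult.assoc of_nat_add)
  show ?thesis
    using triple_sum_reduction[OF q e(1) 1] triple_sum_reduction[OF q e(2) 2] triple_sum_reduction[OF q e(3) 3]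
    unfolding theta28_product[OF q] by (simp add: algebra_simps)
qed

end
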